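(* Let $d\ge 1$ and let $\psi\in\mathcal{C}^2(\mathbb{R}^d)\cap\mathcal{L}^1(\mathbb{R}^d)$ be a scalar-valued positive definite function. Define the matrix-valued functions $\mathbb{R}^d\to\mathbb{C}^{d\times d}$ \[ \boldsymbol{\psi}_1(\mathbf{x})=-\Delta\psi(\mathbf{x})\,\mathbf{I},\qquad \boldsymbol{\psi}_2(\mathbf{x})=-\nabla\nabla^{\top}\psi(\mathbf{x}),\qquad \boldsymbol{\psi}_3(\mathbf{x})=-\Delta\psi(\mathbf{x})\,\mathbf{I}+\nabla\nabla^{\top}\psi(\mathbf{x}), \] where $\nabla\nabla^{\top}\psi$ is the Hessian matrix of $\psi$ and $\mathbf{I}$ the $d\times d$ identity. Then each of $\boldsymbol{\psi}_1,\boldsymbol{\psi}_2,\boldsymbol{\psi}_3$ is positive definite, provided it is integrable over $\mathbb{R}^d$.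
   Context: A continuous scalar function $\psi:\mathbb{R}^d\to\mathbb{C}$ is positive definite if for every finite set of pairwise distinct points $\mathbf{x}_1,\dots,\mathbf{x}_N\in\mathbb{R}^d$ and all $c_1,\dots,c_N\in\mathbb{C}$, $\sum_{j,k}\overline{c_j}c_k\psi(\mathbf{x}_j-\mathbf{x}_k)$ is real and $\ge 0$, with equality only if all $c_j=0$. A continuous matrix function $\boldsymbol{\psi}:\mathbb{R}^d\to\mathbb{C}^{n\times n}$ is positive semi-definite if for every set of pairwise distinct points $\mathbf{x}_1,\dots,\mathbf{x}_N\in\mathbb{R}^d$ and all vectors $\boldsymbol{\alpha}_1,\dots,\boldsymbol{\alpha}_N\in\mathbb{C}^n$, the quantity $\sum_{j=1}^N\sum_{k=1}^N\overline{\boldsymbol{\alpha}_j}^{\top}\boldsymbol{\psi}(\mathbf{x}_j-\mathbf{x}_k)\boldsymbol{\alpha}_k$ is real and $\ge 0$; it is positive definite if moreover this quantity equals $0$ only when $\boldsymbol{\alpha}_1=\dots=\boldsymbol{\alpha}_N=\mathbf{0}$.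
   Formalization: The claim for ψ₃ is stated only for d ≥ 2, because for d = 1 one has ψ₃ = −ψ'' + ψ'' = 0, which is integrable but never positive definite; the claims for ψ₁ and ψ₂ are for all d ≥ 1. *)

theory Defs
  imports "HOL-Analysis.Analysis"
begin

definition C2_UNIV :: "(real^'n \<Rightarrow> complex) \<Rightarrow> bool" where
  "C2_UNIV f \<longleftrightarrow>
     (\<exists>(f' :: real^'n \<Rightarrow> ((real^'n) \<Rightarrow>\<^sub>L complex))
        (f'' :: real^'n \<Rightarrow> ((real^'n) \<Rightarrow>\<^sub>L ((real^'n) \<Rightarrow>\<^sub>L complex))).
        (\<forall>x. (f has_derivative blinfun_apply (f' x)) (at x)) \<and>
        (\<forall>x. (f' has_derivative blinfun_apply (f'' x)) (at x)) \<and>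
        continuous_on UNIV f'')"

definition partial_deriv :: "'n \<Rightarrow> (real^'n \<Rightarrow> complex) \<Rightarrow> real^'n \<Rightarrow> complex" where
  "partial_deriv i f x = frechet_derivative f (at x) (axis i 1)"

definition hessian :: "(real^'n \<Rightarrow> complex) \<Rightarrow> real^'n \<Rightarrow> complex^'n^'n" where
  "hessian f x = (\<chi> i j. partial_deriv i (partial_deriv j f) x)"

definition laplacian :: "(real^'n \<Rightarrow> complex) \<Rightarrow> real^'n \<Rightarrow> complex" where
  "laplacian f x = (\<Sum>i\<in>UNIV. partial_deriv i (partial_deriv i f) x)"

definition pos_def_fun :: "(real^'n \<Rightarrow> complex) \<Rightarrow> bool" where
  "pos_def_fun \<psi> \<longleftrightarrow> continuous_on UNIV \<psi> \<and>
     (\<forall>(N::nat) (x :: nat \<Rightarrow> real^'n) (c :: nat \<Rightarrow> complex).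
        inj_on x {..<N} \<longrightarrow>
        (let Q = (\<Sum>j<N. \<Sum>k<N. cnj (c j) * c k * \<psi> (x j - x k)) in
           Im Q = 0 \<and> Re Q \<ge> 0 \<and> (Q = 0 \<longrightarrow> (\<forall>j<N. c j = 0))))"

definition mat_quad_form ::
  "(real^'n \<Rightarrow> complex^'m^'m) \<Rightarrow> nat \<Rightarrow> (nat \<Rightarrow> real^'n) \<Rightarrow> (nat \<Rightarrow> complex^'m) \<Rightarrow> complex" where
  "mat_quad_form \<Psi> N x \<alpha> =
     (\<Sum>j<N. \<Sum>k<N. \<Sum>a\<in>UNIV. \<Sum>b\<in>UNIV. cnj (\<alpha> j $ a) * (\<Psi> (x j - x k) $ a $ b) * (\<alpha> k $ b))"

definition mat_pos_def_fun :: "(real^'n \<Rightarrow> complex^'m^'m) \<Rightarrow> bool" where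
  "mat_pos_def_fun \<Psi> \<longleftrightarrow> continuous_on UNIV \<Psi> \<and>
     (\<forall>(N::nat) (x :: nat \<Rightarrow> real^'n) (\<alpha> :: nat \<Rightarrow> complex^'m).
        inj_on x {..<N} \<longrightarrow>
        (let Q = mat_quad_form \<Psi> N x \<alpha> in
           Im Q = 0 \<and> Re Q \<ge> 0 \<and> (Q = 0 \<longrightarrow> (\<forall>j<N. \<alpha> j = 0))))"

definition psi1 :: "(real^'n \<Rightarrow> complex) \<Rightarrow> real^'n \<Rightarrow> complex^'n^'n" where
  "psi1 \<psi> x = - (mat (laplacian \<psi> x))"

definition psi2 :: "(real^'n \<Rightarrow> complex) \<Rightarrow> real^'n \<Rightarrow> complex^'n^'n" where
  "psi2 \<psi> x = - hessian \<psi> x"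

definition psi3 :: "(real^'n \<Rightarrow> complex) \<Rightarrow> real^'n \<Rightarrow> complex^'n^'n" where
  "psi3 \<psi> x = - (mat (laplacian \<psi> x)) + hessian \<psi> x"

end

theory Submission
  imports Defs "HOL-Real_Asymp.Real_Asymp"
begin

text \<open>Everything reduces to \<open>\<psi>\<^sub>2\<close>: the form of \<open>\<psi>\<^sub>1\<close> at the vectors \<open>\<alpha>\<^sub>k\<close> is the sum over \<open>a, c\<close> of the
  forms of \<open>\<psi>\<^sub>2\<close> at \<open>\<alpha>\<^sub>k\<^sub>a e\<^sub>c\<close>, and twice the form of \<open>\<psi>\<^sub>3\<close> is the sum of those at
  \<open>\<alpha>\<^sub>k\<^sub>a e\<^sub>c - \<alpha>\<^sub>k\<^sub>c e\<^sub>a\<close>. The form of \<open>\<psi>\<^sub>2\<close> is the energy, with respect to \<open>\<psi>\<close>, of the first-order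
  functional given by the sum of the directional derivatives along \<open>\<alpha>\<^sub>k\<close> at \<open>x\<^sub>k\<close>, hence a limit of energies
  of point masses and therefore nonnegative. If it is zero, then, as in the Cauchy--Schwarz inequality,
  adding a point mass at \<open>y\<close> shows that the sum of the \<open>\<alpha>\<^sub>k \<bullet> \<nabla>\<psi>(y - x\<^sub>k)\<close> vanishes for all \<open>y\<close>. Taking
  Fourier transforms, the exponential polynomial with summands \<open>(\<alpha>\<^sub>k \<bullet> w) exp (i w \<bullet> x\<^sub>k)\<close> vanishes
  on the nonempty open set where the Fourier transform of \<open>\<psi>\<close> is not zero, so all \<open>\<alpha>\<^sub>k\<close> are zero.\<close>

section \<open>Translations and integration by parts\<close>

lemma
  fixes f :: "'a::euclidean_space \<Rightarrow> 'b::{banach, second_countable_topology}"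
  assumes "integrable lborel f"
  shows integrable_lborel_translation: "integrable lborel (\<lambda>x. f (x + c))"
    and integral_lborel_translation: "(LINT x|lborel. f (x + c)) = (LINT x|lborel. f x)"
proof -
  have [measurable]: "f \<in> borel_measurable borel"
    using assms by auto
  have eq: "distr lborel borel (\<lambda>x. x + c) = (lborel :: 'a measure)"
    using lborel_distr_plus[of c] by (simp add: add.commute[of _ c])
  have "integrable (distr lborel borel (\<lambda>x. x + c)) f"
    using assms by (simp add: eq)
  then show "integrable lborel (\<lambda>x. f (x + c))"
    by (subst (asm) integrable_distr_eq) auto
  have "(LINT x|lborel. f (x + c)) = integral\<^sup>L (distr lborel borel (\<lambda>x. x + c)) f"
    by (subst integral_distr) auto
  then show "(LINT x|lborel. f (x + c)) = (LINT x|lborel. f x)"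
    by (simp add: eq)
qed

lemma integrable_lborel_compact_support:
  fixes f :: "'a::euclidean_space \<Rightarrow> 'b::{banach, second_countable_topology}"
  assumes "continuous_on UNIV f" and "\<And>x. norm x > R \<Longrightarrow> f x = 0"
  shows "integrable lborel f"
proof -
  have "(\<lambda>x. indicator (cball 0 R) x *\<^sub>R f x) = f"
    using assms(2) by (auto simp: indicator_def fun_eq_iff not_le)
  with borel_integrable_compact[of "cball 0 R" f] continuous_on_subset[OF assms(1)]
  show ?thesis by auto
qed

text \<open>Mean value inequality for the curve
  \<open>t \<mapsto> G (x + t *\<^sub>R v) - t *\<^sub>R L\<close>. With \<open>L = 0\<close> it
  bounds difference quotients uniformly, as dominated convergence requires; with a nonzero
  \<open>L\<close> it measures how far a quotient is from its expected limit.\<close>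

lemma norm_difference_quotient_le:
  fixes G :: "'a::real_normed_vector \<Rightarrow> 'b::real_normed_vector"
  assumes der: "\<And>t. t \<in> {0..e} \<Longrightarrow> (G has_derivative G' (x + t *\<^sub>R v)) (at (x + t *\<^sub>R v))"
    and bound: "\<And>t. t \<in> {0..e} \<Longrightarrow> norm (G' (x + t *\<^sub>R v) v - L) \<le> M"
    and "0 < e"
  shows "norm ((1/e) *\<^sub>R (G (x + e *\<^sub>R v) - G x) - L) \<le> M"
proof -
  have der': "((\<lambda>t. G (x + t *\<^sub>R v) - t *\<^sub>R L) has_vector_derivative (G' (x + t *\<^sub>R v) v - L)) (at t)"
    if "t \<in> {0..e}" for t
  proof -
    have "((\<lambda>t. G (x + t *\<^sub>R v)) has_derivative (\<lambda>h. G' (x + t *\<^sub>R v) (h *\<^sub>R v))) (at t)"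
      by (rule has_derivative_compose[where g = G and f = "\<lambda>t. x + t *\<^sub>R v", OF _ der[OF that]])
        (auto intro!: derivative_eq_intros)
    moreover have "G' (x + t *\<^sub>R v) (h *\<^sub>R v) = h *\<^sub>R G' (x + t *\<^sub>R v) v" for h
      using linear_cmul[OF has_derivative_linear[OF der[OF that]]] .
    ultimately show ?thesis
      unfolding has_vector_derivative_def
      by (auto intro!: derivative_eq_intros simp: scaleR_diff_right)
  qed
  have "norm ((G (x + e *\<^sub>R v) - e *\<^sub>R L) - (G (x + 0 *\<^sub>R v) - 0 *\<^sub>R L)) \<le> e * M - 0 * M"
  proof (rule differentiable_bound_general[where \<phi> = "\<lambda>t. t * M" and \<phi>' = "\<lambda>_. M" and
        f' = "\<lambda>t. G' (x + t *\<^sub>R v) v - L" and f = "\<lambda>t. G (x + t *\<^sub>R v) - t *\<^sub>R L" and a = 0 and b = e])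
    show "continuous_on {0..e} (\<lambda>t. G (x + t *\<^sub>R v) - t *\<^sub>R L)"
      by (intro continuous_at_imp_continuous_on ballI has_vector_derivative_continuous[OF der'])
  qed (use der' bound \<open>0 < e\<close> in \<open>auto intro!: continuous_intros derivative_eq_intros\<close>)
  then have "norm (G (x + e *\<^sub>R v) - G x - e *\<^sub>R L) \<le> e * M"
    by (simp add: algebra_simps)
  moreover have "(1/e) *\<^sub>R (G (x + e *\<^sub>R v) - G x) - L = (1/e) *\<^sub>R (G (x + e *\<^sub>R v) - G x - e *\<^sub>R L)"
    using \<open>0 < e\<close> by (simp add: scaleR_diff_right)
  ultimately show ?thesis
    using \<open>0 < e\<close> by (simp add: divide_simps mult.commute)
qed

text \<open>The steps \<open>e n\<close> may have either sign: derivatives in the second argument of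
  a kernel \<open>\<psi> (y - x)\<close> lead to the negative steps \<open>- e n\<close>.\<close>

lemma tendsto_difference_quotient:
  fixes G :: "'a::real_normed_vector \<Rightarrow> 'b::real_normed_vector"
  assumes "(G has_derivative G') (at x)" and e: "e \<longlonglongrightarrow> 0" "\<And>n. e n \<noteq> 0"
  shows "(\<lambda>n. (1 / e n) *\<^sub>R (G (x + e n *\<^sub>R v) - G x)) \<longlonglongrightarrow> G' v"
proof -
  have "((\<lambda>t. G (x + t *\<^sub>R v)) has_vector_derivative G' v) (at 0)"
  proof -
    have "((\<lambda>t. G (x + t *\<^sub>R v)) has_derivative (\<lambda>h. G' (h *\<^sub>R v))) (at 0)"
      by (rule has_derivative_compose[where g = G and g' = G' and f = "\<lambda>t. x + t *\<^sub>R v"])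
        (use assms in \<open>auto intro!: derivative_eq_intros\<close>)
    then show ?thesis
      using linear_cmul[OF has_derivative_linear[OF assms(1)]]
      by (simp add: has_vector_derivative_def)
  qed
  then have "((\<lambda>h. norm (G (x + h *\<^sub>R v) - G x - h *\<^sub>R G' v) / norm h) \<longlongrightarrow> 0) (at 0)"
    by (simp add: has_vector_derivative_def has_derivative_at)
  moreover have "norm (G (x + h *\<^sub>R v) - G x - h *\<^sub>R G' v) / norm h
      = norm ((1/h) *\<^sub>R (G (x + h *\<^sub>R v) - G x) - G' v)" if "h \<noteq> 0" for h
  proof -
    have "(1/h) *\<^sub>R (G (x + h *\<^sub>R v) - G x) - G' v = (1/h) *\<^sub>R (G (x + h *\<^sub>R v) - G x - h *\<^sub>R G' v)"
      using that by (simp add: scaleR_diff_right)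
    then show ?thesis by (simp add: divide_simps)
  qed
  ultimately have "((\<lambda>h. norm ((1/h) *\<^sub>R (G (x + h *\<^sub>R v) - G x) - G' v)) \<longlongrightarrow> 0) (at 0)"
    by (subst tendsto_cong[where g = "\<lambda>h. norm (G (x + h *\<^sub>R v) - G x - h *\<^sub>R G' v) / norm h"])
      (auto simp: eventually_at_filter)
  moreover have "filterlim e (at 0) sequentially"
    using e by (simp add: filterlim_at)
  ultimately have "(\<lambda>n. norm ((1 / e n) *\<^sub>R (G (x + e n *\<^sub>R v) - G x) - G' v)) \<longlonglongrightarrow> 0"
    by (rule filterlim_compose)
  then show ?thesis
    by (rule LIM_zero_cancel[OF tendsto_norm_zero_cancel])
qed

text \<open>By translation invariance every difference quotient of \<open>G\<close> has integral
  zero, and dominated convergence carries this over to the derivative. Applied to a product, this is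
  integration by parts.\<close>

lemma integral_directional_derivative_eq_0:
  fixes G :: "'a::euclidean_space \<Rightarrow> 'b::euclidean_space"
  assumes der: "\<And>x. (G has_derivative G' x) (at x)"
    and cont: "continuous_on UNIV (\<lambda>x. G' x v)"
    and supp: "\<And>x. norm x > R \<Longrightarrow> G x = 0"
  shows "(LINT x|lborel. G' x v) = 0"
proof -
  define e :: "nat \<Rightarrow> real" where "e n = 1 / Suc n" for n
  define q where "q n x = (1 / e n) *\<^sub>R (G (x + e n *\<^sub>R v) - G x)" for n x
  have e: "e \<longlonglongrightarrow> 0" "\<And>n. e n \<noteq> 0" "\<And>n. 0 < e n" "\<And>n. e n \<le> 1"
    unfolding e_def using LIMSEQ_inverse_real_of_nat by (auto simp: inverse_eq_divide field_simps)
  have contG: "continuous_on UNIV G"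
    using der by (meson continuous_at_imp_continuous_on has_derivative_continuous)
  have [measurable]: "G \<in> borel_measurable borel" "(\<lambda>x. G' x v) \<in> borel_measurable borel"
    using contG cont by (auto intro: borel_measurable_continuous_onI)
  have intG: "integrable lborel G"
    by (rule integrable_lborel_compact_support[OF contG supp])
  \<comment> \<open>As \<open>e n \<le> 1\<close>, the quotients vanish outside the ball of radius
    \<open>R + norm v\<close>, and segments of direction \<open>v\<close> starting in that ball stay
    in the ball of radius \<open>R + 2 * norm v\<close>.\<close>
  have "compact ((\<lambda>x. G' x v) ` cball 0 (R + 2 * norm v))"
    by (intro compact_continuous_image continuous_on_subset[OF cont]) auto
  then obtain M where M: "\<And>x. norm x \<le> R + 2 * norm v \<Longrightarrow> norm (G' x v) \<le> M"
    by (force dest!: compact_imp_bounded simp: bounded_iff)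
  have "(\<lambda>n. LINT x|lborel. q n x) \<longlonglongrightarrow> (LINT x|lborel. G' x v)"
  proof (rule integral_dominated_convergence[where w = "\<lambda>x. indicator (cball 0 (R + norm v)) x *\<^sub>R M"])
    show "integrable lborel (\<lambda>x::'a. indicator (cball 0 (R + norm v)) x *\<^sub>R M)"
      by (rule borel_integrable_compact) simp_all
    show "AE x in lborel. (\<lambda>n. q n x) \<longlonglongrightarrow> G' x v"
      unfolding q_def by (intro AE_I2 tendsto_difference_quotient[OF der e(1,2)])
    fix n
    have "norm (q n x) \<le> indicator (cball 0 (R + norm v)) x *\<^sub>R M" for x
    proof (cases "norm x \<le> R + norm v")
      case True
      have "norm (q n x - 0) \<le> M"
        unfolding q_def
      proof (rule norm_difference_quotient_le[where G' = G'])
        fix t assume t: "t \<in> {0..e n}"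
        then have "norm (t *\<^sub>R v) \<le> norm v"
          using e(4)[of n] by (simp add: mult_left_le_one_le)
        then have "norm (x + t *\<^sub>R v) \<le> R + 2 * norm v"
          using True norm_triangle_ineq[of x "t *\<^sub>R v"] by linarith
        then show "norm (G' (x + t *\<^sub>R v) v - 0) \<le> M"
          using M by simp
      qed (use der e in auto)
      then show ?thesis using True by simp
    next
      case False
      have "norm (e n *\<^sub>R v) \<le> norm v"
        using e(3,4)[of n] by (simp add: mult_left_le_one_le)
      then have "norm (x + e n *\<^sub>R v) > R"
        using False norm_triangle_ineq4[of "x + e n *\<^sub>R v" "e n *\<^sub>R v"] by simp
      moreover have "norm x > R"
        using False by (smt (verit) norm_ge_zero)
      ultimately show ?thesis using False by (simp add: q_def supp)
    qed
    then show "AE x in lborel. norm (q n x) \<le> indicator (cball 0 (R + norm v)) x *\<^sub>R M"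
      by auto
  qed (simp_all add: q_def)
  moreover have "(LINT x|lborel. q n x) = 0" for n
    using integrable_lborel_translation[OF intG, of "e n *\<^sub>R v"]
      integral_lborel_translation[OF intG, of "e n *\<^sub>R v"] intG
    by (simp add: q_def)
  ultimately show ?thesis
    by (simp add: LIMSEQ_const_iff)
qed

section \<open>Mixed difference quotients\<close>

text \<open>Up to a factor, the expression is the difference quotient in direction
  \<open>- v\<close> of \<open>G y = f (y + t *\<^sub>R u) - f y\<close>. Near \<open>d\<close> the
  derivative of \<open>G\<close> is \<open>t *\<^sub>R f'' u\<close> up to o(t), because
  \<open>f'\<close> is differentiable at \<open>d\<close>. The opposite signs of \<open>u\<close>
  and \<open>v\<close> are those of a difference of two displaced points.\<close>

lemma tendsto_mixed_difference_quotient: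
  fixes f :: "'a::real_normed_vector \<Rightarrow> 'b::real_normed_vector"
  assumes der: "\<And>x. (f has_derivative blinfun_apply (f' x)) (at x)"
    and der2: "(f' has_derivative f'') (at d)"
    and e: "e \<longlonglongrightarrow> 0" "\<And>n. 0 < e n"
  shows "(\<lambda>n. (1 / (e n)\<^sup>2) *\<^sub>R (f (d + e n *\<^sub>R u - e n *\<^sub>R v) - f (d + e n *\<^sub>R u) - f (d - e n *\<^sub>R v) + f d))
    \<longlonglongrightarrow> - blinfun_apply (f'' u) v"
proof (rule LIMSEQ_I)
  fix r :: real assume "r > 0"
  let ?q = "\<lambda>n. (1 / (e n)\<^sup>2) *\<^sub>R (f (d + e n *\<^sub>R u - e n *\<^sub>R v) - f (d + e n *\<^sub>R u) - f (d - e n *\<^sub>R v) + f d)"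
  \<comment> \<open>The displacements \<open>k1\<close> and \<open>k2\<close> below have norms
    adding up to at most \<open>t * (2 * norm v + norm u)\<close>; the factor \<open>norm v\<close>
    comes from evaluating at \<open>v\<close>, and the summand 1 makes \<open>C\<close> positive.
    The final error is \<open>\<eta> * C = r / 2\<close>.\<close>
  define C where "C = (2 * norm v + norm u) * norm v + 1"
  have "C > 0" by (simp add: C_def add_nonneg_pos)
  define \<eta> where "\<eta> = r / (2 * C)"
  have "\<eta> > 0" using \<open>r > 0\<close> \<open>C > 0\<close> by (simp add: \<eta>_def)
  obtain \<delta> where "\<delta> > 0" and \<delta>: "\<And>k. norm k < \<delta> \<Longrightarrow> norm (f' (d + k) - f' d - f'' k) \<le> \<eta> * norm k"
    using der2 \<open>\<eta> > 0\<close> unfolding has_derivative_at_alt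
    by (metis add_diff_cancel_left')
  have lin: "linear f''"
    using der2 by (rule has_derivative_linear)
  have "(\<lambda>n. e n * (norm v + norm u)) \<longlonglongrightarrow> 0 * (norm v + norm u)"
    by (intro tendsto_intros e)
  then have "\<forall>\<^sub>F n in sequentially. e n * (norm v + norm u) < \<delta>"
    using \<open>\<delta> > 0\<close> by (simp add: order_tendsto_iff)
  then obtain N where N: "\<And>n. n \<ge> N \<Longrightarrow> e n * (norm v + norm u) < \<delta>"
    by (auto simp: eventually_sequentially)
  have "norm (?q n - - blinfun_apply (f'' u) v) < r" if "n \<ge> N" for n
  proof -
    define t where "t = e n"
    have "t > 0" using e by (simp add: t_def)
    define G where "G y = f (y + t *\<^sub>R u) - f y" for y
    have "norm ((1/t) *\<^sub>R (G (d + t *\<^sub>R (- v)) - G d) - (- t *\<^sub>R blinfun_apply (f'' u) v)) \<le> t * (\<eta> * C)"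
    proof (rule norm_difference_quotient_le[where G' = "\<lambda>y h. blinfun_apply (f' (y + t *\<^sub>R u)) h - blinfun_apply (f' y) h"])
      fix s assume s: "s \<in> {0..t}"
      show "(G has_derivative (\<lambda>h. blinfun_apply (f' (d + s *\<^sub>R - v + t *\<^sub>R u)) h - blinfun_apply (f' (d + s *\<^sub>R - v)) h))
          (at (d + s *\<^sub>R - v))"
        unfolding G_def
        by (intro has_derivative_diff der has_derivative_compose[where f = "\<lambda>y. y + t *\<^sub>R u" and f' = "\<lambda>h. h", OF _ der])
          (auto intro!: derivative_eq_intros)
      define k2 where "k2 = s *\<^sub>R - v"
      define k1 where "k1 = k2 + t *\<^sub>R u"
      have k2: "norm k2 \<le> t * norm v"
        using s by (simp add: k2_def mult_right_mono)
      have k1: "norm k1 \<le> t * norm v + t * norm u"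
        unfolding k1_def using k2 norm_triangle_ineq[of k2 "t *\<^sub>R u"] \<open>t > 0\<close> by simp
      have small: "norm k1 < \<delta>" "norm k2 < \<delta>"
        using N[OF that] k1 k2 mult_nonneg_nonneg[OF less_imp_le[OF \<open>t > 0\<close>] norm_ge_zero[of u]]
        unfolding t_def[symmetric] distrib_left by linarith+
      have "f'' k1 - f'' k2 = t *\<^sub>R f'' u"
        using lin by (simp add: k1_def linear_add linear_cmul)
      then have "f' (d + k1) - f' (d + k2) - t *\<^sub>R f'' u
          = (f' (d + k1) - f' d - f'' k1) - (f' (d + k2) - f' d - f'' k2)"
        by (simp add: algebra_simps)
      also have "norm \<dots> \<le> \<eta> * norm k1 + \<eta> * norm k2"
        by (intro order_trans[OF norm_triangle_ineq4] add_mono \<delta> small)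
      also have "\<dots> \<le> \<eta> * (t * norm v + t * norm u) + \<eta> * (t * norm v)"
        using k1 k2 \<open>\<eta> > 0\<close> by (intro add_mono mult_left_mono) auto
      finally have bound: "norm (f' (d + k1) - f' (d + k2) - t *\<^sub>R f'' u) \<le> t * \<eta> * (2 * norm v + norm u)"
        by (simp add: algebra_simps)
      have "norm (blinfun_apply (f' (d + k1)) (- v) - blinfun_apply (f' (d + k2)) (- v) - (- t *\<^sub>R blinfun_apply (f'' u) v))
          = norm (blinfun_apply (f' (d + k1) - f' (d + k2) - t *\<^sub>R f'' u) v)"
        by (subst norm_minus_cancel[symmetric])
          (simp add: blinfun.bilinear_simps algebra_simps)
      also have "\<dots> \<le> t * \<eta> * (2 * norm v + norm u) * norm v"
        by (intro order_trans[OF norm_blinfun] mult_right_mono bound) auto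
      also have "\<dots> \<le> t * (\<eta> * C)"
        using \<open>t > 0\<close> \<open>\<eta> > 0\<close> by (simp add: C_def algebra_simps)
      finally show "norm (blinfun_apply (f' (d + s *\<^sub>R - v + t *\<^sub>R u)) (- v) - blinfun_apply (f' (d + s *\<^sub>R - v)) (- v)
          - (- t *\<^sub>R blinfun_apply (f'' u) v)) \<le> t * (\<eta> * C)"
        unfolding k1_def k2_def add.assoc .
    qed fact
    moreover have "(1/t) *\<^sub>R (G (d + t *\<^sub>R (- v)) - G d) - (- t *\<^sub>R blinfun_apply (f'' u) v)
        = t *\<^sub>R (?q n - - blinfun_apply (f'' u) v)"
      using \<open>t > 0\<close> unfolding t_def[symmetric]
      by (simp add: G_def power2_eq_square algebra_simps)
    ultimately have "norm (?q n - - blinfun_apply (f'' u) v) \<le> \<eta> * C"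
      using \<open>t > 0\<close> by simp
    also have "\<dots> < r"
      using \<open>r > 0\<close> \<open>C > 0\<close> by (simp add: \<eta>_def)
    finally show ?thesis .
  qed
  then show "\<exists>N. \<forall>n\<ge>N. norm (?q n - - blinfun_apply (f'' u) v) < r"
    by blast
qed

text \<open>The mixed second difference quotient is symmetric in \<open>u\<close> and
  \<open>v\<close>, hence so is its limit.\<close>

lemma second_derivative_symmetric:
  fixes f :: "'a::real_normed_vector \<Rightarrow> 'b::real_normed_vector"
  assumes der: "\<And>x. (f has_derivative blinfun_apply (f' x)) (at x)"
    and der2: "(f' has_derivative f'') (at d)"
  shows "blinfun_apply (f'' u) v = blinfun_apply (f'' v) u"
proof -
  define e :: "nat \<Rightarrow> real" where "e n = 1 / Suc n" for n
  have e: "e \<longlonglongrightarrow> 0" "\<And>n. 0 < e n"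
    unfolding e_def using LIMSEQ_inverse_real_of_nat by (auto simp: inverse_eq_divide)
  define D where "D n u v = (1 / (e n)\<^sup>2) *\<^sub>R (f (d + e n *\<^sub>R u + e n *\<^sub>R v) - f (d + e n *\<^sub>R u) - f (d + e n *\<^sub>R v) + f d)"
    for n u v
  have "(\<lambda>n. D n u v) \<longlonglongrightarrow> blinfun_apply (f'' u) v" for u v
    using tendsto_mixed_difference_quotient[OF der der2 e, of u "- v"]
    by (simp add: D_def blinfun.bilinear_simps)
  moreover have "D n u v = D n v u" for n
    by (simp add: D_def algebra_simps)
  ultimately show ?thesis
    by (metis (no_types, lifting) LIMSEQ_unique ext)
qed

section \<open>Energies of first-order functionals\<close>

lemma pos_def_fun_sum:
  fixes c :: "'i \<Rightarrow> complex" and p :: "'i \<Rightarrow> real^'n"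
  assumes "pos_def_fun \<psi>" "finite I"
  defines "Q \<equiv> (\<Sum>i\<in>I. \<Sum>j\<in>I. cnj (c i) * c j * \<psi> (p i - p j))"
  shows "Im Q = 0" "Re Q \<ge> 0"
proof -
  obtain h where h: "bij_betw h {0..<card (p ` I)} (p ` I)"
    using ex_bij_betw_nat_finite[of "p ` I"] \<open>finite I\<close> by auto
  then have h': "bij_betw h {..<card (p ` I)} (p ` I)"
    by (simp add: atLeast0LessThan)
  define C where "C z = (\<Sum>i\<in>{i\<in>I. p i = z}. c i)" for z
  have group: "(\<Sum>i\<in>I. c' i * F (p i)) = (\<Sum>z\<in>p ` I. (\<Sum>i\<in>{i\<in>I. p i = z}. c' i) * F z)"
    for F :: "real^'n \<Rightarrow> complex" and c' :: "'i \<Rightarrow> complex"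
    by (subst sum.image_gen[OF \<open>finite I\<close>, of _ p]) (simp add: sum_distrib_right)
  have "Q = (\<Sum>i\<in>I. cnj (c i) * (\<Sum>j\<in>I. c j * \<psi> (p i - p j)))"
    unfolding Q_def by (simp add: sum_distrib_left mult.assoc)
  also have "\<dots> = (\<Sum>i\<in>I. cnj (c i) * (\<Sum>z\<in>p ` I. C z * \<psi> (p i - z)))"
    unfolding C_def using group[of c "\<lambda>z. \<psi> (p i - z)" for i] by simp
  also have "\<dots> = (\<Sum>w\<in>p ` I. cnj (C w) * (\<Sum>z\<in>p ` I. C z * \<psi> (w - z)))"
    unfolding C_def cnj_sum by (rule group)
  also have "\<dots> = (\<Sum>j<card (p ` I). \<Sum>k<card (p ` I). cnj (C (h j)) * C (h k) * \<psi> (h j - h k))"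
    by (simp add: sum.reindex_bij_betw[OF h', symmetric] sum_distrib_left mult.assoc)
  finally have Q: "Q = \<dots>" .
  have "inj_on h {..<card (p ` I)}"
    using h' by (rule bij_betw_imp_inj_on)
  with assms(1) show "Im Q = 0" "Re Q \<ge> 0"
    unfolding Q pos_def_fun_def Let_def by (blast dest: spec[of _ "\<lambda>j. C (h j)"])+
qed

text \<open>\<open>E\<close> is the energy of the functional that maps \<open>h\<close> to the sum of the \<open>c\<^sub>j D h(x\<^sub>j) v\<^sub>j\<close> plus
  \<open>s h(y)\<close>. Its difference quotients are combinations of point masses, and \<open>E\<close> is the limit of their
  energies. The indices \<open>Some (j, True)\<close>, \<open>Some (j, False)\<close> and \<open>None\<close> stand for the displaced point,
  the base point \<open>x\<^sub>j\<close> and \<open>y\<close>.\<close>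

lemma pos_def_fun_derivative_energy:
  fixes \<psi> :: "real^'n \<Rightarrow> complex" and c :: "'j \<Rightarrow> complex" and v x :: "'j \<Rightarrow> real^'n" and s y
  assumes pd: "pos_def_fun \<psi>" and "finite J"
    and der: "\<And>x. (\<psi> has_derivative blinfun_apply (\<psi>' x)) (at x)"
    and der2: "\<And>x. (\<psi>' has_derivative \<psi>'' x) (at x)"
  defines "E \<equiv> (\<Sum>i\<in>J. \<Sum>j\<in>J. cnj (c i) * c j * - blinfun_apply (\<psi>'' (x i - x j) (v i)) (v j))
      + cnj s * (\<Sum>j\<in>J. c j * - blinfun_apply (\<psi>' (y - x j)) (v j))
      + s * (\<Sum>i\<in>J. cnj (c i) * blinfun_apply (\<psi>' (x i - y)) (v i)) + cnj s * s * \<psi> 0"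
  shows "Im E = 0" "Re E \<ge> 0"
proof -
  define e :: "nat \<Rightarrow> real" where "e n = 1 / Suc n" for n
  have e: "e \<longlonglongrightarrow> 0" "\<And>n. e n \<noteq> 0" "\<And>n. 0 < e n" "\<And>n. - e n \<noteq> 0"
    unfolding e_def using LIMSEQ_inverse_real_of_nat by (auto simp: inverse_eq_divide field_simps)
  define I where "I = insert None (Some ` (J \<times> (UNIV :: bool set)))"
  define \<gamma> where "\<gamma> n i = (case i of None \<Rightarrow> s | Some (j, t) \<Rightarrow> (if t then c j else - c j) / of_real (e n))"
    for n and i :: "('j \<times> bool) option"
  define p where "p n i = (case i of None \<Rightarrow> y | Some (j, t) \<Rightarrow> x j + (if t then e n else 0) *\<^sub>R v j)"
    for n and i :: "('j \<times> bool) option"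
  define Q where "Q n = (\<Sum>i\<in>I. \<Sum>j\<in>I. cnj (\<gamma> n i) * \<gamma> n j * \<psi> (p n i - p n j))" for n
  define m where "m n i j = (1 / (e n)\<^sup>2) *\<^sub>R (\<psi> (x i - x j + e n *\<^sub>R v i - e n *\<^sub>R v j)
     - \<psi> (x i - x j + e n *\<^sub>R v i) - \<psi> (x i - x j - e n *\<^sub>R v j) + \<psi> (x i - x j))" for n i j
  have sum_I: "(\<Sum>i\<in>I. F i) = F None + (\<Sum>j\<in>J. F (Some (j, True)) + F (Some (j, False)))"
    for F :: "('j \<times> bool) option \<Rightarrow> complex"
  proof -
    have "(\<Sum>i\<in>I. F i) = F None + (\<Sum>q\<in>J \<times> UNIV. F (Some q))"
      unfolding I_def using \<open>finite J\<close> by (subst sum.insert) (auto simp: sum.reindex)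
    also have "(\<Sum>q\<in>J \<times> UNIV. F (Some q)) = (\<Sum>j\<in>J. \<Sum>t\<in>UNIV. F (Some (j, t)))"
      by (subst sum.cartesian_product) (auto intro: sum.cong)
    finally show ?thesis
      by (simp add: UNIV_bool add.commute)
  qed
  \<comment> \<open>Displacing \<open>x j\<close> moves the argument \<open>y - x j\<close> by
    \<open>- e n *\<^sub>R v j\<close>. Writing the corresponding quotient with step
    \<open>- e n\<close> produces the minus sign in front of the derivative in
    \<open>E\<close>.\<close>
  have Q: "Q n = (\<Sum>i\<in>J. \<Sum>j\<in>J. cnj (c i) * c j * m n i j)
      + cnj s * (\<Sum>j\<in>J. c j * - ((1 / - e n) *\<^sub>R (\<psi> ((y - x j) + (- e n) *\<^sub>R v j) - \<psi> (y - x j))))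
      + s * (\<Sum>i\<in>J. cnj (c i) * ((1 / e n) *\<^sub>R (\<psi> ((x i - y) + e n *\<^sub>R v i) - \<psi> (x i - y)))) + cnj s * s * \<psi> 0" for n
  proof -
    have cross: "cnj (\<gamma> n (Some (i, True))) * \<gamma> n (Some (j, True)) * \<psi> (p n (Some (i, True)) - p n (Some (j, True)))
       + cnj (\<gamma> n (Some (i, True))) * \<gamma> n (Some (j, False)) * \<psi> (p n (Some (i, True)) - p n (Some (j, False)))
       + (cnj (\<gamma> n (Some (i, False))) * \<gamma> n (Some (j, True)) * \<psi> (p n (Some (i, False)) - p n (Some (j, True)))
       + cnj (\<gamma> n (Some (i, False))) * \<gamma> n (Some (j, False)) * \<psi> (p n (Some (i, False)) - p n (Some (j, False))))
       = cnj (c i) * c j * m n i j" for i j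
    proof -
      have "x i + e n *\<^sub>R v i - (x j + e n *\<^sub>R v j) = x i - x j + e n *\<^sub>R v i - e n *\<^sub>R v j"
        "x i + e n *\<^sub>R v i - x j = x i - x j + e n *\<^sub>R v i"
        "x i - (x j + e n *\<^sub>R v j) = x i - x j - e n *\<^sub>R v j"
        by simp_all
      then show ?thesis
        using e(2)[of n] by (simp add: \<gamma>_def p_def m_def scaleR_conv_of_real field_simps power2_eq_square)
    qed
    have right: "cnj s * \<gamma> n (Some (j, True)) * \<psi> (y - p n (Some (j, True)))
        + cnj s * \<gamma> n (Some (j, False)) * \<psi> (y - p n (Some (j, False)))
        = cnj s * (c j * - ((1 / - e n) *\<^sub>R (\<psi> ((y - x j) + (- e n) *\<^sub>R v j) - \<psi> (y - x j))))" for j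
    proof -
      have "y - (x j + e n *\<^sub>R v j) = (y - x j) + (- e n) *\<^sub>R v j" by simp
      then show ?thesis
        using e(2)[of n] by (simp add: \<gamma>_def p_def scaleR_conv_of_real field_simps)
    qed
    have left: "cnj (\<gamma> n (Some (i, True))) * s * \<psi> (p n (Some (i, True)) - y)
        + cnj (\<gamma> n (Some (i, False))) * s * \<psi> (p n (Some (i, False)) - y)
        = s * (cnj (c i) * ((1 / e n) *\<^sub>R (\<psi> ((x i - y) + e n *\<^sub>R v i) - \<psi> (x i - y))))" for i
    proof -
      have "x i + e n *\<^sub>R v i - y = (x i - y) + e n *\<^sub>R v i" by simp
      then show ?thesis
        using e(2)[of n] by (simp add: \<gamma>_def p_def scaleR_conv_of_real field_simps)
    qed
    have none: "\<gamma> n None = s" "p n None = y"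
      by (simp_all add: \<gamma>_def p_def)
    show ?thesis
      unfolding Q_def sum_I none sum_distrib_left cross[symmetric] right[symmetric] left[symmetric]
      by (simp add: sum.distrib add_ac)
  qed
  have "Q \<longlonglongrightarrow> E"
    unfolding Q[abs_def] E_def m_def
    by (intro tendsto_intros tendsto_mixed_difference_quotient[OF der der2 e(1,3)]
        tendsto_difference_quotient[OF der] e(1,2,4) tendsto_minus[OF e(1), simplified])
  then have "(\<lambda>n. Im (Q n)) \<longlonglongrightarrow> Im E" "(\<lambda>n. Re (Q n)) \<longlonglongrightarrow> Re E"
    by (auto intro: tendsto_intros)
  moreover have "Im (Q n) = 0" "Re (Q n) \<ge> 0" for n
    using pos_def_fun_sum[OF pd, of I "\<gamma> n" "p n"] \<open>finite J\<close> by (auto simp: Q_def I_def)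
  ultimately show "Im E = 0" "Re E \<ge> 0"
    by (auto simp: LIMSEQ_const_iff intro: LIMSEQ_le_const)
qed

text \<open>Adding \<open>s\<close> times a point mass at \<open>y\<close> to a functional of zero
  energy gives an energy without constant term in \<open>s\<close>, namely 2 Re(conj(s) A) + |s|^2
  \<open>\<psi> 0\<close>. It can be nonnegative for all \<open>s\<close> only if the linear
  coefficient A vanishes.\<close>

lemma pos_def_fun_zero_energy:
  fixes \<psi> :: "real^'n \<Rightarrow> complex" and c :: "'j \<Rightarrow> complex" and v x :: "'j \<Rightarrow> real^'n"
  assumes pd: "pos_def_fun \<psi>" and "finite J"
    and der: "\<And>x. (\<psi> has_derivative blinfun_apply (\<psi>' x)) (at x)"
    and der2: "\<And>x. (\<psi>' has_derivative \<psi>'' x) (at x)"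
    and zero: "(\<Sum>i\<in>J. \<Sum>j\<in>J. cnj (c i) * c j * - blinfun_apply (\<psi>'' (x i - x j) (v i)) (v j)) = 0"
  shows "(\<Sum>j\<in>J. c j * blinfun_apply (\<psi>' (y - x j)) (v j)) = 0"
proof -
  define A where "A = (\<Sum>j\<in>J. c j * - blinfun_apply (\<psi>' (y - x j)) (v j))"
  define B where "B = (\<Sum>i\<in>J. cnj (c i) * blinfun_apply (\<psi>' (x i - y)) (v i))"
  have E: "Im (cnj s * A + s * B + cnj s * s * \<psi> 0) = 0" "Re (cnj s * A + s * B + cnj s * s * \<psi> 0) \<ge> 0" for s
    using pos_def_fun_derivative_energy[OF pd \<open>finite J\<close> der der2, of c x v s y]
    unfolding zero A_def B_def by simp_all
  have "Im (\<psi> 0) = 0" "Re (\<psi> 0) \<ge> 0"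
    using pos_def_fun_sum[OF pd, of "{()}" "\<lambda>_. 1"] by auto
  \<comment> \<open>The energy is real: \<open>s = 1\<close> compares the imaginary parts of
    \<open>A\<close> and \<open>B\<close>, and \<open>s = \<i>\<close> the real parts.\<close>
  moreover from this have "B = cnj A"
    using E(1)[of 1] E(1)[of \<i>] by (simp add: complex_eq_iff)
  \<comment> \<open>With \<open>s = - t A\<close> the linear terms contribute
    \<open>- 2 * t * (cmod A)\<^sup>2\<close>, and \<open>t * Re (\<psi> 0) < 2\<close> makes them
    dominate the quadratic one. The summand 1 excludes division by zero.\<close>
  define t where "t = 1 / (Re (\<psi> 0) + 1)"
  have "Re (cnj (- of_real t * A) * A + (- of_real t * A) * B + cnj (- of_real t * A) * (- of_real t * A) * \<psi> 0)
      = t * (t * Re (\<psi> 0) - 2) * (cmod A)\<^sup>2"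
    unfolding \<open>B = cnj A\<close> cmod_power2 using \<open>Im (\<psi> 0) = 0\<close>
    by (simp add: algebra_simps power2_eq_square)
  then have "0 \<le> t * (t * Re (\<psi> 0) - 2) * (cmod A)\<^sup>2"
    using E(2)[of "- of_real t * A"] by simp
  moreover have "t > 0" "t * Re (\<psi> 0) < 2"
    using \<open>Re (\<psi> 0) \<ge> 0\<close> by (simp_all add: t_def field_simps)
  then have "t * (t * Re (\<psi> 0) - 2) < 0"
    by (simp add: mult_pos_neg)
  ultimately have "\<not> 0 < (cmod A)\<^sup>2"
    using mult_neg_pos[of "t * (t * Re (\<psi> 0) - 2)" "(cmod A)\<^sup>2"] by linarith
  then have "A = 0" by simp
  then show ?thesis by (simp add: A_def sum_negf)
qed

section \<open>Fourier integrals\<close>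

text \<open>Squaring the positive part removes its kink at 0, which makes it a convenient profile
  for a compactly supported C^1 cutoff.\<close>

lemma has_real_derivative_square_pos_part:
  fixes t :: real
  shows "((\<lambda>t. (max 0 t)\<^sup>2) has_real_derivative 2 * max 0 t) (at t)"
proof -
  consider "t < 0" | "t = 0" | "t > 0" by linarith
  then show ?thesis
  proof cases
    case 1
    have "((\<lambda>t. 0::real) has_real_derivative 0) (at t)" by simp
    then have "((\<lambda>t::real. (max 0 t)\<^sup>2) has_real_derivative 0) (at t)"
      by (rule has_field_derivative_transform_within_open[where S = "{..<0}"]) (use 1 in auto)
    then show ?thesis using 1 by simp
  next
    case 2
    have "((\<lambda>h::real. (max 0 h)\<^sup>2 / h) \<longlongrightarrow> 0) (at 0)"
    proof (rule Lim_null_comparison)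
      show "\<forall>\<^sub>F h in at (0::real). norm ((max 0 h)\<^sup>2 / h) \<le> \<bar>h\<bar>"
        by (auto simp: eventually_at_filter max_def power2_eq_square)
    qed (auto intro!: tendsto_eq_intros)
    then show ?thesis using 2 by (simp add: has_field_derivative_iff)
  next
    case 3
    have "((\<lambda>t. t\<^sup>2) has_real_derivative 2 * t) (at t)"
      by (auto intro!: derivative_eq_intros)
    then have "((\<lambda>t::real. (max 0 t)\<^sup>2) has_real_derivative 2 * t) (at t)"
      by (rule has_field_derivative_transform_within_open[where S = "{0<..}"]) (use 3 in auto)
    then show ?thesis using 3 by simp
  qed
qed

text \<open>Dominated convergence with majorant \<open>norm (f x)\<close>. Continuity ensures that
  the set of frequencies with nonzero Fourier integral is open.\<close>

lemma continuous_on_Fourier_integral: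
  fixes f :: "'a::euclidean_space \<Rightarrow> complex"
  assumes int: "integrable lborel f"
  shows "continuous_on UNIV (\<lambda>w. LINT x|lborel. f x * cis (w \<bullet> x))"
  unfolding continuous_on_sequentially o_def
proof (intro allI ballI impI, elim conjE)
  fix w :: "nat \<Rightarrow> 'a" and w0
  assume w: "w \<longlonglongrightarrow> w0"
  have [measurable]: "f \<in> borel_measurable borel" using int by auto
  have [measurable]: "(\<lambda>x. cis (w \<bullet> x)) \<in> borel_measurable borel" for w :: 'a
    by (intro borel_measurable_continuous_onI continuous_intros)
  show "(\<lambda>n. LINT x|lborel. f x * cis (w n \<bullet> x)) \<longlonglongrightarrow> (LINT x|lborel. f x * cis (w0 \<bullet> x))"
  proof (rule integral_dominated_convergence[where w = "\<lambda>x. norm (f x)"])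
    show "AE x in lborel. (\<lambda>n. f x * cis (w n \<bullet> x)) \<longlonglongrightarrow> f x * cis (w0 \<bullet> x)"
      by (intro AE_I2 tendsto_intros tendsto_cis w)
  qed (use int in \<open>auto simp: norm_mult\<close>)
qed

text \<open>The equation \<open>zero\<close> is tested against \<open>cis (w \<bullet> y)\<close> times a \<open>C\<^sup>1\<close> cutoff at scale \<open>n\<close>: the
  derivative of \<open>f\<close> need not be integrable, so it has to be moved to the test function before \<open>n\<close>
  tends to infinity.\<close>

lemma Fourier_integral_derivative_combination:
  fixes f :: "'a::euclidean_space \<Rightarrow> complex" and c :: "'j \<Rightarrow> complex" and v x :: "'j \<Rightarrow> 'a"
  assumes "finite J" and int: "integrable lborel f"
    and der: "\<And>x. (f has_derivative blinfun_apply (f' x)) (at x)"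
    and cont': "continuous_on UNIV f'"
    and zero: "\<And>y. (\<Sum>j\<in>J. c j * blinfun_apply (f' (y - x j)) (v j)) = 0"
  shows "(\<Sum>j\<in>J. c j * of_real (w \<bullet> v j) * cis (w \<bullet> x j)) * (LINT z|lborel. f z * cis (w \<bullet> z)) = 0"
proof -
  define e :: "nat \<Rightarrow> real" where "e n = 1 / Suc n" for n
  have e: "e \<longlonglongrightarrow> 0" "\<And>n. 0 < e n" "\<And>n. e n \<le> 1"
    unfolding e_def using LIMSEQ_inverse_real_of_nat by (auto simp: inverse_eq_divide field_simps)
  \<comment> \<open>This factor vanishes outside the ball of radius \<open>1 / e n\<close> and tends
    to 1 pointwise; its square, which enters \<open>g\<close>, is C^1.\<close>
  define \<kappa> where "\<kappa> n z = max 0 (1 - (e n)\<^sup>2 * (z \<bullet> z))" for n and z :: 'a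
  define g where "g n z = cis (w \<bullet> z) * of_real ((\<kappa> n z)\<^sup>2)" for n z
  define g' where "g' n z h = cis (w \<bullet> z) * (\<i> * of_real ((\<kappa> n z)\<^sup>2 * (w \<bullet> h))
    - of_real (4 * \<kappa> n z * ((e n)\<^sup>2 * (z \<bullet> h))))" for n z h
  have der_g: "(g n has_derivative g' n z) (at z)" for n z
  proof -
    have "((\<lambda>z. 1 - (e n)\<^sup>2 * (z \<bullet> z)) has_derivative (\<lambda>h. - (2 * (e n)\<^sup>2 * (z \<bullet> h)))) (at z)"
      by (auto intro!: derivative_eq_intros simp: inner_commute)
    from DERIV_compose_FDERIV[OF has_real_derivative_square_pos_part this]
    have "((\<lambda>z. (\<kappa> n z)\<^sup>2) has_derivative (\<lambda>h. - (2 * (e n)\<^sup>2 * (z \<bullet> h)) * (2 * \<kappa> n z))) (at z)"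
      by (simp add: \<kappa>_def)
    note cutoff = has_derivative_of_real[OF this]
    have "((\<lambda>z. cis (w \<bullet> z)) has_derivative (\<lambda>h. (w \<bullet> h) *\<^sub>R (\<i> * cis (w \<bullet> z)))) (at z)"
      by (auto intro!: derivative_eq_intros)
    from has_derivative_mult[OF this cutoff] show ?thesis
      unfolding g_def[abs_def]
      by (rule has_derivative_eq_rhs)
        (simp add: g'_def[abs_def] fun_eq_iff scaleR_conv_of_real algebra_simps)
  qed
  have cont: "continuous_on UNIV f"
    using der by (meson continuous_at_imp_continuous_on has_derivative_continuous)
  have cont_shift: "continuous_on UNIV (\<lambda>y. f (y - a))" "continuous_on UNIV (\<lambda>y. f' (y - a))" for a
    by (auto intro!: continuous_on_compose2[OF cont] continuous_on_compose2[OF cont'] continuous_intros)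
  have cont_\<kappa>: "continuous_on UNIV (\<kappa> n)" for n
    unfolding \<kappa>_def by (intro continuous_intros)
  have cont_g: "continuous_on UNIV (g n)" "continuous_on UNIV (\<lambda>z. g' n z h)" for n h
    unfolding g_def g'_def by (intro continuous_intros cont_\<kappa>)+
  have [measurable]: "(\<lambda>y. f (y - a)) \<in> borel_measurable borel" "(\<lambda>z. g' n z h) \<in> borel_measurable borel" for n h a
    using cont_shift cont_g by (auto intro: borel_measurable_continuous_onI)
  have [measurable]: "(\<lambda>x. cis (w \<bullet> x)) \<in> borel_measurable borel"
    by (intro borel_measurable_continuous_onI continuous_intros)
  have supp: "\<kappa> n z = 0" if "norm z > 1 / e n" for n z
  proof -
    have "1 < e n * norm z"
      using that e(2)[of n] by (simp add: field_simps)
    then have "1 < (e n * norm z)\<^sup>2"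
      by (simp add: one_less_power)
    then show ?thesis
      by (simp add: \<kappa>_def power_mult_distrib power2_norm_eq_inner)
  qed
  have int_shift: "integrable lborel (\<lambda>y. f (y - a))" for a
    using integrable_lborel_translation[OF int, of "- a"] by simp
  let ?F = "\<lambda>n y. \<Sum>j\<in>J. c j * (f (y - x j) * g' n y (v j))"
  \<comment> \<open>The derivative of each compactly supported product
    \<open>f (y - x j) * g n y\<close> has integral zero. In the combination with coefficients
    \<open>c j\<close>, the terms containing \<open>f'\<close> cancel by \<open>zero\<close>, and
    only derivatives of \<open>g n\<close> remain.\<close>
  have F_0: "(LINT y|lborel. ?F n y) = 0" for n
  proof -
    let ?G = "\<lambda>j y. f (y - x j) * g n y"
    let ?G' = "\<lambda>j y h. f (y - x j) * g' n y h + blinfun_apply (f' (y - x j)) h * g n y"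
    have contG': "continuous_on UNIV (\<lambda>y. ?G' j y (v j))" for j
      by (intro continuous_intros cont_shift cont_g)
    have "(LINT y|lborel. ?G' j y (v j)) = 0" for j
    proof (rule integral_directional_derivative_eq_0[where R = "1 / e n" and G = "?G j"])
      fix y
      have "((\<lambda>y. f (y - x j)) has_derivative blinfun_apply (f' (y - x j))) (at y)"
        by (rule has_derivative_compose[where f = "\<lambda>y. y - x j" and f' = "\<lambda>h. h", OF _ der])
          (auto intro!: derivative_eq_intros)
      then show "(?G j has_derivative ?G' j y) (at y)"
        by (rule has_derivative_mult[OF _ der_g])
    qed (use contG' supp in \<open>auto simp: g_def\<close>)
    moreover have "integrable lborel (\<lambda>y. ?G' j y (v j))" for j
      by (rule integrable_lborel_compact_support[OF contG', of "1 / e n"])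
        (simp add: g_def g'_def supp)
    ultimately have "(LINT y|lborel. (\<Sum>j\<in>J. c j * ?G' j y (v j))) = 0"
      by (subst Bochner_Integration.integral_sum) auto
    moreover have "(\<Sum>j\<in>J. c j * ?G' j y (v j)) = ?F n y" for y
    proof -
      have "(\<Sum>j\<in>J. c j * ?G' j y (v j)) = ?F n y + (\<Sum>j\<in>J. c j * blinfun_apply (f' (y - x j)) (v j)) * g n y"
        by (simp add: sum_distrib_right distrib_left sum.distrib mult.assoc)
      then show ?thesis by (simp add: zero)
    qed
    ultimately show ?thesis by simp
  qed
  \<comment> \<open>The bound does not depend on \<open>n\<close>: where the cutoff is nonzero,
    \<open>e n * norm y \<le> 1\<close> compensates the growth of \<open>y\<close> in its
    derivative. An integrable majorant results from the integrability of \<open>f\<close>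
    alone.\<close>
  have g'_bound: "norm (g' n y h) \<le> \<bar>w \<bullet> h\<bar> + 4 * norm h" for n y h
  proof (cases "norm y > 1 / e n")
    case True
    then show ?thesis by (simp add: g'_def supp)
  next
    case False
    then have "e n * norm y \<le> 1"
      using e(2)[of n] by (simp add: field_simps)
    then have "e n * (e n * norm y * norm h) \<le> 1 * (1 * norm h)"
      using e(2,3)[of n] by (intro mult_mono) auto
    moreover have "\<bar>y \<bullet> h\<bar> \<le> norm y * norm h"
      by (rule Cauchy_Schwarz_ineq2)
    then have "(e n)\<^sup>2 * \<bar>y \<bullet> h\<bar> \<le> e n * (e n * norm y * norm h)"
      by (simp add: power2_eq_square mult.assoc mult_left_mono less_imp_le[OF e(2)])
    ultimately have "(e n)\<^sup>2 * \<bar>y \<bullet> h\<bar> \<le> norm h" by simp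
    moreover have \<kappa>: "0 \<le> \<kappa> n y" "\<kappa> n y \<le> 1"
      by (auto simp: \<kappa>_def)
    ultimately have "4 * \<kappa> n y * ((e n)\<^sup>2 * \<bar>y \<bullet> h\<bar>) \<le> 4 * 1 * norm h"
      by (intro mult_mono) auto
    moreover have "(\<kappa> n y)\<^sup>2 * \<bar>w \<bullet> h\<bar> \<le> 1 * \<bar>w \<bullet> h\<bar>"
      using \<kappa> by (intro mult_right_mono power_le_one) auto
    moreover have "norm (g' n y h) \<le> (\<kappa> n y)\<^sup>2 * \<bar>w \<bullet> h\<bar> + 4 * \<kappa> n y * ((e n)\<^sup>2 * \<bar>y \<bullet> h\<bar>)"
    proof -
      have "norm (\<i> * complex_of_real ((\<kappa> n y)\<^sup>2 * (w \<bullet> h))) = (\<kappa> n y)\<^sup>2 * \<bar>w \<bullet> h\<bar>"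
        "norm (complex_of_real (4 * \<kappa> n y * ((e n)\<^sup>2 * (y \<bullet> h)))) = 4 * \<kappa> n y * ((e n)\<^sup>2 * \<bar>y \<bullet> h\<bar>)"
        unfolding norm_mult norm_of_real using \<kappa> by (simp_all add: abs_mult)
      then show ?thesis
        unfolding g'_def norm_mult[of "cis _"] norm_cis mult_1_left by (metis norm_triangle_ineq4)
    qed
    ultimately show ?thesis by linarith
  qed
  have "(\<lambda>n. LINT y|lborel. ?F n y) \<longlonglongrightarrow>
      (LINT y|lborel. (\<Sum>j\<in>J. c j * (f (y - x j) * (cis (w \<bullet> y) * (\<i> * of_real (w \<bullet> v j))))))"
  proof (rule integral_dominated_convergence[where
        w = "\<lambda>y. \<Sum>j\<in>J. norm (c j) * (norm (f (y - x j)) * (\<bar>w \<bullet> v j\<bar> + 4 * norm (v j)))"])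
    show "integrable lborel (\<lambda>y. \<Sum>j\<in>J. norm (c j) * (norm (f (y - x j)) * (\<bar>w \<bullet> v j\<bar> + 4 * norm (v j))))"
      using int_shift by auto
    show "AE y in lborel. norm (?F n y) \<le> (\<Sum>j\<in>J. norm (c j) * (norm (f (y - x j)) * (\<bar>w \<bullet> v j\<bar> + 4 * norm (v j))))" for n
    proof (intro AE_I2 sum_norm_le)
      fix y j
      show "norm (c j * (f (y - x j) * g' n y (v j))) \<le> norm (c j) * (norm (f (y - x j)) * (\<bar>w \<bullet> v j\<bar> + 4 * norm (v j)))"
        unfolding norm_mult by (intro mult_left_mono g'_bound) auto
    qed
    show "AE y in lborel. (\<lambda>n. ?F n y) \<longlonglongrightarrow> (\<Sum>j\<in>J. c j * (f (y - x j) * (cis (w \<bullet> y) * (\<i> * of_real (w \<bullet> v j)))))"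
    proof (rule AE_I2)
      fix y
      have \<kappa>: "(\<lambda>n. \<kappa> n y) \<longlonglongrightarrow> 1"
        unfolding \<kappa>_def by (auto intro!: tendsto_eq_intros e(1))
      have "(\<lambda>n. g' n y h) \<longlonglongrightarrow> cis (w \<bullet> y) * (\<i> * of_real (1\<^sup>2 * (w \<bullet> h)) - of_real (4 * 1 * (0\<^sup>2 * (y \<bullet> h))))" for h
        unfolding g'_def by (intro tendsto_intros \<kappa> e(1))
      then show "(\<lambda>n. ?F n y) \<longlonglongrightarrow> (\<Sum>j\<in>J. c j * (f (y - x j) * (cis (w \<bullet> y) * (\<i> * of_real (w \<bullet> v j)))))"
        by (intro tendsto_intros) simp
    qed
  qed measurable
  then have "(LINT y|lborel. (\<Sum>j\<in>J. c j * (f (y - x j) * (cis (w \<bullet> y) * (\<i> * of_real (w \<bullet> v j)))))) = 0"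
    by (simp add: F_0 LIMSEQ_const_iff)
  moreover have int_j: "integrable lborel (\<lambda>y. c j * (f (y - x j) * (cis (w \<bullet> y) * (\<i> * of_real (w \<bullet> v j)))))"
    and val_j: "(LINT y|lborel. c j * (f (y - x j) * (cis (w \<bullet> y) * (\<i> * of_real (w \<bullet> v j)))))
      = \<i> * (c j * of_real (w \<bullet> v j) * cis (w \<bullet> x j) * (LINT z|lborel. f z * cis (w \<bullet> z)))" for j
  proof -
    \<comment> \<open>Translating by \<open>x j\<close> brings out the character value
      \<open>cis (w \<bullet> x j)\<close> and leaves the same Fourier integral for every
      \<open>j\<close>.\<close>
    have eq: "c j * (f (y - x j) * (cis (w \<bullet> y) * (\<i> * of_real (w \<bullet> v j))))
        = \<i> * (c j * of_real (w \<bullet> v j) * cis (w \<bullet> x j)) * (f (y + - x j) * cis (w \<bullet> (y + - x j)))" for y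
    proof -
      have "cis (w \<bullet> y) = cis (w \<bullet> x j) * cis (w \<bullet> (y + - x j))"
        by (simp add: cis_mult inner_diff_right)
      then show ?thesis by simp
    qed
    have *: "integrable lborel (\<lambda>z. f z * cis (w \<bullet> z))"
      by (rule Bochner_Integration.integrable_bound[OF int])
        (use borel_measurable_continuous_onI[OF cont] in \<open>auto simp: norm_mult\<close>)
    show "integrable lborel (\<lambda>y. c j * (f (y - x j) * (cis (w \<bullet> y) * (\<i> * of_real (w \<bullet> v j)))))"
      unfolding eq using integrable_lborel_translation[OF *, of "- x j"] by auto
    show "(LINT y|lborel. c j * (f (y - x j) * (cis (w \<bullet> y) * (\<i> * of_real (w \<bullet> v j)))))
      = \<i> * (c j * of_real (w \<bullet> v j) * cis (w \<bullet> x j) * (LINT z|lborel. f z * cis (w \<bullet> z)))"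
      unfolding eq integral_mult_right_zero integral_lborel_translation[OF *] by simp
  qed
  ultimately have "\<i> * ((\<Sum>j\<in>J. c j * of_real (w \<bullet> v j) * cis (w \<bullet> x j)) * (LINT z|lborel. f z * cis (w \<bullet> z))) = 0"
    by (simp only: Bochner_Integration.integral_sum[OF int_j] val_j flip: sum_distrib_left sum_distrib_right)
  then show ?thesis by simp
qed

section \<open>Gaussian test functions and nonvanishing of the Fourier integral\<close>

text \<open>The logarithm of the cosine is -u^2/2 + o(u^2) at u = 0. The asymptotic computation is
  done for positive arguments; evenness of the cosine covers negative ones.\<close>

lemma cos_power_tendsto_gaussian:
  fixes t :: real
  shows "(\<lambda>n. cos (t / real n) ^ (n\<^sup>2)) \<longlonglongrightarrow> exp (- t\<^sup>2 / 2)"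
proof -
  have *: "(\<lambda>n. cos (s / real n) ^ (n\<^sup>2)) \<longlonglongrightarrow> exp (- s\<^sup>2 / 2)" if "s > 0" for s :: real
  proof -
    have "(\<lambda>n::nat. exp (real n ^ 2 * ln (cos (s / real n)))) \<longlonglongrightarrow> exp (- (s * s / 2))"
      using that by real_asymp
    moreover have "\<forall>\<^sub>F n in sequentially. cos (s / real n) > 0"
      using that by real_asymp
    then have "\<forall>\<^sub>F n in sequentially. exp (real n ^ 2 * ln (cos (s / real n))) = cos (s / real n) ^ (n\<^sup>2)"
      by eventually_elim (simp flip: ln_realpow of_nat_power)
    ultimately have "(\<lambda>n. cos (s / real n) ^ (n\<^sup>2)) \<longlonglongrightarrow> exp (- (s * s / 2))"
      by (rule Lim_transform_eventually)
    then show ?thesis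
      by (simp add: power2_eq_square)
  qed
  consider "t = 0" | "t > 0" | "- t > 0" by linarith
  then show ?thesis
    using *[of t] *[of "- t"] by cases auto
qed

text \<open>If the Fourier integral vanished, \<open>f\<close> would be orthogonal to all trigonometric polynomials,
  hence, since the products of \<open>cos (x\<^sub>b / n)\<close> raised to the power \<open>n\<^sup>2\<close> converge boundedly to a
  Gaussian, to all powers of a Gaussian. Normalized to be \<open>1\<close> at distance \<open>r\<close> from the origin, these
  are at least \<open>1\<close> in the ball of radius \<open>r\<close> and tend to \<open>0\<close> outside.\<close>

lemma ex_Fourier_integral_nonzero:
  fixes f :: "'a::euclidean_space \<Rightarrow> complex"
  assumes int: "integrable lborel f" and cont: "continuous_on UNIV f" and pos: "Re (f 0) > 0"
  shows "\<exists>w. (LINT x|lborel. f x * cis (w \<bullet> x)) \<noteq> 0"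
proof (rule ccontr)
  assume "\<not> ?thesis"
  then have zero: "(LINT x|lborel. f x * cis (w \<bullet> x)) = 0" for w
    by blast
  \<comment> \<open>Asking for all frequencies \<open>w\<close> makes this class closed under
    multiplication by cosines, and the bound by 1 keeps \<open>norm (f x)\<close> a majorant in
    every limit. The constant 1 belongs to the class by \<open>zero\<close>.\<close>
  define ann where "ann \<phi> \<longleftrightarrow> \<phi> \<in> borel_measurable borel \<and> (\<forall>x. \<bar>\<phi> x\<bar> \<le> 1) \<and>
    (\<forall>w. (LINT x|lborel. f x * of_real (\<phi> x) * cis (w \<bullet> x)) = 0)" for \<phi> :: "'a \<Rightarrow> real"
  have [measurable]: "f \<in> borel_measurable borel"
    using int by auto
  have [measurable]: "(\<lambda>x. cis (w \<bullet> x)) \<in> borel_measurable borel" for w :: 'a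
    by (intro borel_measurable_continuous_onI continuous_intros)
  have integrable_ann: "integrable lborel (\<lambda>x. f x * of_real (\<phi> x) * cis (w \<bullet> x))"
    if "ann \<phi>" for \<phi> w
  proof (rule Bochner_Integration.integrable_bound[OF int])
    have [measurable]: "\<phi> \<in> borel_measurable borel"
      using that by (simp add: ann_def)
    show "(\<lambda>x. f x * of_real (\<phi> x) * cis (w \<bullet> x)) \<in> borel_measurable lborel"
      by measurable
    show "AE x in lborel. norm (f x * of_real (\<phi> x) * cis (w \<bullet> x)) \<le> norm (f x)"
      using that by (auto simp: ann_def norm_mult mult_left_le)
  qed
  \<comment> \<open>Multiplication by the cosine averages the Fourier integrals at the frequencies
    \<open>w + v\<close> and \<open>w - v\<close>, both of which vanish.\<close>
  have ann_cos: "ann (\<lambda>x. \<phi> x * cos (v \<bullet> x))" if "ann \<phi>" for \<phi> v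
  proof -
    have [measurable]: "\<phi> \<in> borel_measurable borel"
      using that by (simp add: ann_def)
    have "(LINT x|lborel. f x * of_real (\<phi> x * cos (v \<bullet> x)) * cis (w \<bullet> x)) = 0" for w
    proof -
      have eq: "f x * of_real (\<phi> x * cos (v \<bullet> x)) * cis (w \<bullet> x) =
          (1/2) * (f x * of_real (\<phi> x) * cis ((w + v) \<bullet> x) + f x * of_real (\<phi> x) * cis ((w - v) \<bullet> x))" for x
      proof -
        have "of_real (cos (v \<bullet> x)) = (1/2) * (cis (v \<bullet> x) + cis (- (v \<bullet> x)))"
          by (simp add: complex_eq_iff)
        moreover have "cis (w \<bullet> x + v \<bullet> x) = cis (w \<bullet> x) * cis (v \<bullet> x)"
          "cis (w \<bullet> x - v \<bullet> x) = cis (w \<bullet> x) * cis (- (v \<bullet> x))"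
          by (simp_all add: cis_mult)
        ultimately show ?thesis
          by (simp only: inner_add_left inner_diff_left) (simp add: algebra_simps)
      qed
      show ?thesis
        unfolding eq using that integrable_ann[OF that] by (simp add: ann_def)
    qed
    then show ?thesis
      using that by (auto simp: ann_def abs_mult intro!: mult_le_one)
  qed
  have ann_cos_power: "ann (\<lambda>x. \<phi> x * cos (v \<bullet> x) ^ m)" if "ann \<phi>" for \<phi> v m
  proof (induction m)
    case (Suc m)
    from ann_cos[OF this, of v] show ?case by (simp add: mult_ac)
  qed (use that in simp)
  have ann_prod: "ann (\<lambda>x. \<phi> x * (\<Prod>b\<in>A. cos ((r *\<^sub>R b) \<bullet> x) ^ m))"
    if "ann \<phi>" "finite A" for \<phi> A r m
    using that(2)
  proof induction
    case (insert b A)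
    from ann_cos_power[OF insert.IH, of "r *\<^sub>R b" m] show ?case
      using insert.hyps by (simp add: mult_ac)
  qed (use that in simp)
  have ann_gaussian: "ann (\<lambda>x. \<phi> x * exp (- (norm x)\<^sup>2 / 2))" if "ann \<phi>" for \<phi>
  proof -
    let ?p = "\<lambda>n x. \<Prod>b\<in>Basis. cos (((1 / real n) *\<^sub>R b) \<bullet> x) ^ (n\<^sup>2)"
    have p: "ann (\<lambda>x. \<phi> x * ?p n x)" for n
      using ann_prod[OF that, of Basis "1 / real n"] by simp
    have [measurable]: "\<phi> \<in> borel_measurable borel"
      using that by (simp add: ann_def)
    have lim: "(\<lambda>n. ?p n x) \<longlonglongrightarrow> exp (- (norm x)\<^sup>2 / 2)" for x
    proof -
      have "(\<lambda>n. \<Prod>b\<in>Basis. cos ((b \<bullet> x) / real n) ^ (n\<^sup>2)) \<longlonglongrightarrow> (\<Prod>b\<in>Basis. exp (- (b \<bullet> x)\<^sup>2 / 2))"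
        by (intro tendsto_prod cos_power_tendsto_gaussian)
      also have "(\<Prod>b\<in>Basis. exp (- (b \<bullet> x)\<^sup>2 / 2)) = exp (- (norm x)\<^sup>2 / 2)"
      proof -
        have "(norm x)\<^sup>2 = (\<Sum>b\<in>Basis. (b \<bullet> x)\<^sup>2)"
          unfolding power2_norm_eq_inner
          by (subst euclidean_inner) (simp add: power2_eq_square inner_commute)
        then show ?thesis
          by (simp add: sum_divide_distrib sum_negf flip: exp_sum)
      qed
      finally show ?thesis by simp
    qed
    have "(LINT x|lborel. f x * of_real (\<phi> x * exp (- (norm x)\<^sup>2 / 2)) * cis (w \<bullet> x)) = 0" for w
    proof -
      have "(\<lambda>n. LINT x|lborel. f x * of_real (\<phi> x * ?p n x) * cis (w \<bullet> x)) \<longlonglongrightarrow>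
          (LINT x|lborel. f x * of_real (\<phi> x * exp (- (norm x)\<^sup>2 / 2)) * cis (w \<bullet> x))"
      proof (rule integral_dominated_convergence[where w = "\<lambda>x. norm (f x)"])
        show "integrable lborel (\<lambda>x. norm (f x))"
          using int by simp
        show "AE x in lborel. (\<lambda>n. f x * of_real (\<phi> x * ?p n x) * cis (w \<bullet> x)) \<longlonglongrightarrow>
            f x * of_real (\<phi> x * exp (- (norm x)\<^sup>2 / 2)) * cis (w \<bullet> x)"
          by (intro AE_I2 tendsto_intros lim)
        show "AE x in lborel. norm (f x * of_real (\<phi> x * ?p n x) * cis (w \<bullet> x)) \<le> norm (f x)" for n
        proof (rule AE_I2)
          fix x
          have "\<bar>\<phi> x * ?p n x\<bar> \<le> 1"
            using p[of n] by (simp only: ann_def)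
          then show "norm (f x * of_real (\<phi> x * ?p n x) * cis (w \<bullet> x)) \<le> norm (f x)"
            unfolding norm_mult norm_of_real by (simp add: mult_left_le)
        qed
      qed measurable
      then show ?thesis
        using p by (simp add: ann_def LIMSEQ_const_iff)
    qed
    then show ?thesis
      using that by (auto simp: ann_def abs_mult intro!: mult_le_one)
  qed
  have gauss: "ann (\<lambda>x. exp (- (norm x)\<^sup>2 / 2) ^ m)" for m
  proof (induction m)
    case 0
    show ?case using zero by (simp add: ann_def)
  next
    case (Suc m)
    from ann_gaussian[OF this] show ?case by (simp add: mult_ac)
  qed
  obtain c r where "c > 0" "r > 0" and cr: "\<And>x. norm x \<le> r \<Longrightarrow> c \<le> Re (f x)"
  proof -
    have "isCont f 0"
      using cont by (simp add: continuous_on_eq_continuous_at)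
    then obtain d where d: "d > 0" "\<And>x. dist x 0 < d \<Longrightarrow> dist (f x) (f 0) < Re (f 0) / 2"
      using pos unfolding continuous_at_eps_delta by (metis half_gt_zero)
    show thesis
    proof (rule that[of "Re (f 0) / 2" "d / 2"])
      fix x :: 'a assume "norm x \<le> d / 2"
      then have "dist (f x) (f 0) < Re (f 0) / 2" using d by simp
      then have "\<bar>Re (f x - f 0)\<bar> < Re (f 0) / 2"
        using abs_Re_le_cmod[of "f x - f 0"] by (simp add: dist_norm)
      then show "Re (f 0) / 2 \<le> Re (f x)" unfolding minus_complex.sel by argo
    qed (use d pos in auto)
  qed
  define g where "g x = exp ((r\<^sup>2 - (norm x)\<^sup>2) / 2)" for x :: 'a
  have g: "exp (r\<^sup>2 / 2) * exp (- (norm x)\<^sup>2 / 2) = g x" for x :: 'a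
    by (simp add: g_def diff_divide_distrib flip: exp_add)
  have [measurable]: "g \<in> borel_measurable borel"
    unfolding g_def by measurable
  \<comment> \<open>This is frequency 0: \<open>g x ^ m\<close> is a power of the Gaussian times the
    constant \<open>exp (r\<^sup>2 / 2) ^ m\<close>.\<close>
  have int_g: "integrable lborel (\<lambda>x. Re (f x) * g x ^ m)"
    and int_g_0: "(LINT x|lborel. Re (f x) * g x ^ m) = 0" for m
  proof -
    define h where "h x = f x * of_real (exp (- (norm x)\<^sup>2 / 2) ^ m) * cis (0 \<bullet> x)" for x
    have eq: "Re (f x) * g x ^ m = Re (of_real (exp (r\<^sup>2 / 2) ^ m) * h x)" for x
      by (simp add: h_def power_mult_distrib mult_ac flip: g of_real_power)
    have "integrable lborel h" "integral\<^sup>L lborel h = 0"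
      using integrable_ann[OF gauss[of m], of 0] gauss[of m] unfolding ann_def h_def by blast+
    then have "integrable lborel (\<lambda>x. of_real (exp (r\<^sup>2 / 2) ^ m) * h x)"
      "(LINT x|lborel. of_real (exp (r\<^sup>2 / 2) ^ m) * h x) = 0"
      by simp_all
    then show "integrable lborel (\<lambda>x. Re (f x) * g x ^ m)"
      "(LINT x|lborel. Re (f x) * g x ^ m) = 0"
      unfolding eq using integrable_Re integral_Re by (metis, metis zero_complex.sel(1))
  qed
  let ?B = "cball (0::'a) r"
  have "(\<lambda>m. LINT x|lborel. indicator (- ?B) x *\<^sub>R (Re (f x) * g x ^ m)) \<longlonglongrightarrow> (LINT x|(lborel :: 'a measure). (0::real))"
  proof (rule integral_dominated_convergence[where w = "\<lambda>x. norm (f x)"])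
    show "integrable lborel (\<lambda>x. norm (f x))"
      using int by simp
    have le: "0 \<le> g x" "g x < 1" if "norm x > r" for x
      using that \<open>r > 0\<close> by (simp_all add: g_def power_strict_mono)
    show "AE x in lborel. (\<lambda>m. indicator (- ?B) x *\<^sub>R (Re (f x) * g x ^ m)) \<longlonglongrightarrow> 0"
    proof (rule AE_I2)
      fix x
      show "(\<lambda>m. indicator (- ?B) x *\<^sub>R (Re (f x) * g x ^ m)) \<longlonglongrightarrow> 0"
        using le[of x] by (cases "norm x > r") (auto intro!: tendsto_mult_right_zero LIMSEQ_power_zero)
    qed
    show "AE x in lborel. norm (indicator (- ?B) x *\<^sub>R (Re (f x) * g x ^ m)) \<le> norm (f x)" for m
    proof (rule AE_I2)
      fix x
      show "norm (indicator (- ?B) x *\<^sub>R (Re (f x) * g x ^ m)) \<le> norm (f x)"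
      proof (cases "norm x > r")
        case True
        then have "\<bar>Re (f x)\<bar> * g x ^ m \<le> norm (f x) * 1"
          using le[of x] by (intro mult_mono abs_Re_le_cmod power_le_one) auto
        then show ?thesis using True le[of x] by (simp add: abs_mult)
      qed simp
    qed
  qed measurable
  then have "(\<lambda>m. LINT x|lborel. indicator (- ?B) x *\<^sub>R (Re (f x) * g x ^ m)) \<longlonglongrightarrow> 0"
    by simp
  \<comment> \<open>The whole integral is zero, so the part outside the ball is minus the part
    inside, where the integrand is at least \<open>c\<close>. This keeps the outer part away from
    its limit 0.\<close>
  moreover have "(LINT x|lborel. indicator (- ?B) x *\<^sub>R (Re (f x) * g x ^ m)) \<le> - (c * measure lborel ?B)" for m
  proof -
    have ints: "integrable lborel (\<lambda>x. indicator A x *\<^sub>R (Re (f x) * g x ^ m))" if "A \<in> sets lborel" for A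
      using integrable_mult_indicator[OF that int_g] .
    have "c * measure lborel ?B = (LINT x|lborel. indicator ?B x * c)"
      by (simp add: emeasure_lborel_cball_finite)
    also have "\<dots> \<le> (LINT x|lborel. indicator ?B x *\<^sub>R (Re (f x) * g x ^ m))"
    proof (rule integral_mono)
      show "integrable lborel (\<lambda>x. indicator ?B x * c)"
        using borel_integrable_compact[of ?B "\<lambda>_. c"] by simp
      show "integrable lborel (\<lambda>x. indicator ?B x *\<^sub>R (Re (f x) * g x ^ m))"
        by (rule ints) simp
      fix x
      show "indicator ?B x * c \<le> indicator ?B x *\<^sub>R (Re (f x) * g x ^ m)"
      proof (cases "norm x \<le> r")
        case True
        then have "1 \<le> g x"
          by (simp add: g_def power_mono)
        then have "c * 1 \<le> Re (f x) * g x ^ m"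
          using cr[OF True] \<open>c > 0\<close> by (intro mult_mono one_le_power) auto
        then show ?thesis using True by simp
      qed simp
    qed
    also have "\<dots> = (LINT x|lborel. Re (f x) * g x ^ m) - (LINT x|lborel. indicator (- ?B) x *\<^sub>R (Re (f x) * g x ^ m))"
      by (subst Bochner_Integration.integral_diff[OF int_g ints, symmetric])
        (auto intro!: Bochner_Integration.integral_cong simp: indicator_def)
    finally show ?thesis
      using int_g_0[of m] by simp
  qed
  ultimately have "0 \<le> - (c * measure lborel ?B)"
    by (intro LIMSEQ_le_const2) auto
  moreover have "measure lborel ?B > 0"
    using \<open>r > 0\<close> by (simp add: content_cball_pos)
  ultimately show False
    using mult_pos_pos[OF \<open>c > 0\<close>] by fastforce
qed

section \<open>Exponential polynomials\<close>

text \<open>A sum vanishing on an open set has zero derivative there; subtracting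
  \<open>\<i> * of_real (v \<bullet> y)\<close> times the sum itself shifts every frequency
  \<open>x k\<close> by \<open>y\<close>. The coefficients stay affine in \<open>w\<close>, so the
  step can be iterated.\<close>

lemma sum_cis_directional_derivative:
  fixes L :: "'i \<Rightarrow> 'a::real_inner \<Rightarrow> complex"
  assumes "open U" and lin: "\<And>k. bounded_linear (L k)"
    and zero: "\<And>w. w \<in> U \<Longrightarrow> (\<Sum>k\<in>K. (c k + L k w) * cis (w \<bullet> x k)) = 0"
    and "w \<in> U"
  shows "(\<Sum>k\<in>K. (L k v + \<i> * of_real (v \<bullet> (x k - y)) * (c k + L k w)) * cis (w \<bullet> x k)) = 0"
proof -
  let ?D = "\<lambda>v. \<Sum>k\<in>K. (L k v + \<i> * of_real (v \<bullet> x k) * (c k + L k w)) * cis (w \<bullet> x k)"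
  let ?F = "\<lambda>w. \<Sum>k\<in>K. (c k + L k w) * cis (w \<bullet> x k)"
  have "(?F has_derivative ?D) (at w)"
  proof (rule has_derivative_sum)
    fix k
    have "(L k has_derivative L k) (at w)"
      using lin by (rule bounded_linear_imp_has_derivative)
    then show "((\<lambda>w. (c k + L k w) * cis (w \<bullet> x k)) has_derivative
        (\<lambda>v. (L k v + \<i> * of_real (v \<bullet> x k) * (c k + L k w)) * cis (w \<bullet> x k))) (at w)"
      by (auto intro!: derivative_eq_intros simp: scaleR_conv_of_real algebra_simps)
  qed
  moreover have "(?F has_derivative (\<lambda>_. 0)) (at w)"
    by (rule has_derivative_transform_within_open[OF has_derivative_const[of 0] \<open>open U\<close> \<open>w \<in> U\<close>])
      (simp add: zero)
  ultimately have "?D = (\<lambda>_. 0)"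
    by (rule has_derivative_unique)
  then have "?D v - \<i> * of_real (v \<bullet> y) * ?F w = 0"
    using zero[OF \<open>w \<in> U\<close>] by (simp add: fun_eq_iff)
  moreover have "?D v - \<i> * of_real (v \<bullet> y) * ?F w =
      (\<Sum>k\<in>K. (L k v + \<i> * of_real (v \<bullet> (x k - y)) * (c k + L k w)) * cis (w \<bullet> x k))"
    unfolding sum_distrib_left sum_subtractf[symmetric]
    by (intro sum.cong) (simp_all add: algebra_simps inner_diff_right)
  ultimately show ?thesis by simp
qed

text \<open>The operator \<open>D\<^sub>v - \<i> (v \<bullet> x\<^sub>j)\<close>, applied twice, annihilates the \<open>j\<close>-th summand; with
  \<open>v = x\<^sub>m - x\<^sub>j\<close> it only scales the linear part of the \<open>m\<close>-th summand by a nonzero factor.\<close>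

lemma sum_cis_linear_part_eq_0:
  fixes L :: "'i \<Rightarrow> 'a::real_inner \<Rightarrow> complex"
  assumes "finite K" "m \<notin> K" "inj_on x (insert m K)" "open U" "U \<noteq> {}"
    and "\<And>k. bounded_linear (L k)"
    and "\<And>w. w \<in> U \<Longrightarrow> (\<Sum>k\<in>insert m K. (c k + L k w) * cis (w \<bullet> x k)) = 0"
  shows "L m v = 0"
  using assms(1-3,6-)
proof (induction K arbitrary: c L rule: finite_induct)
  case empty
  then have zero: "c m + L m w = 0" if "w \<in> U" for w
    using that by simp
  obtain w where "w \<in> U" using \<open>U \<noteq> {}\<close> by auto
  \<comment> \<open>On \<open>U\<close> the map \<open>L m\<close> equals the constant
    \<open>- c m\<close>, so its derivative, which is \<open>L m\<close> itself, is zero.\<close>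
  have "(L m has_derivative L m) (at w)"
    using empty.prems by (intro bounded_linear_imp_has_derivative)
  moreover have "(L m has_derivative (\<lambda>_. 0)) (at w)"
    by (rule has_derivative_transform_within_open[OF has_derivative_const[of "- c m"] \<open>open U\<close> \<open>w \<in> U\<close>])
      (metis zero add_eq_0_iff)
  ultimately show ?case
    by (metis has_derivative_unique)
next
  case (insert j K)
  define u where "u = x m - x j"
  define s where "s k = \<i> * complex_of_real (u \<bullet> (x k - x j))" for k
  have "x m \<noteq> x j"
    using insert.prems insert.hyps by (auto simp: inj_on_def)
  then have "s m \<noteq> 0"
    by (simp add: s_def u_def)
  let ?M = "insert m (insert j K)"
  have lin: "bounded_linear (\<lambda>w. a * L k w)" for a k
    using insert.prems(3) by (rule bounded_linear_const_mult)
  \<comment> \<open>Since \<open>s j = 0\<close>, one application reduces the coefficient of index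
    \<open>j\<close> to the constant \<open>L j u\<close>; the second one removes it.\<close>
  have step1: "(\<Sum>k\<in>?M. ((L k u + s k * c k) + s k * L k w) * cis (w \<bullet> x k)) = 0" if "w \<in> U" for w
    using sum_cis_directional_derivative[OF \<open>open U\<close> insert.prems(3,4) that,
        where v = u and y = "x j"]
    by (simp add: s_def algebra_simps)
  have step2: "(\<Sum>k\<in>?M. ((s k * L k u + s k * (L k u + s k * c k)) + s k * (s k * L k w)) * cis (w \<bullet> x k)) = 0"
    if "w \<in> U" for w
    using sum_cis_directional_derivative[where L = "\<lambda>k w. s k * L k w", OF \<open>open U\<close> lin step1 that,
        where v = u and y = "x j"]
    by (simp add: s_def algebra_simps)
  \<comment> \<open>The induction hypothesis applies to the sum without index \<open>j\<close>: its
    constant parts are arbitrary, and the linear part at \<open>m\<close> is \<open>L m\<close>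
    times a nonzero factor.\<close>
  have "(s m * s m) * L m v = 0"
  proof (rule insert.IH[where c = "\<lambda>k. s k * L k u + s k * (L k u + s k * c k)" and L = "\<lambda>k w. (s k * s k) * L k w"])
    fix w assume "w \<in> U"
    have "s j = 0" by (simp add: s_def)
    moreover have "insert m (insert j K) = insert j (insert m K)" by auto
    ultimately show "(\<Sum>k\<in>insert m K. (s k * L k u + s k * (L k u + s k * c k) + s k * s k * L k w) * cis (w \<bullet> x k)) = 0"
      using step2[OF \<open>w \<in> U\<close>] insert.hyps insert.prems(1)
      by (subst (asm) (2) insert_commute) (simp add: mult.assoc)
  qed (use insert.prems lin in \<open>auto simp: inj_on_def\<close>)
  then show ?case
    using \<open>s m \<noteq> 0\<close> by simp
qed

section \<open>Matrix-valued functions\<close>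

text \<open>Uniqueness of Frechet derivatives turns partial derivatives into evaluations at unit
  vectors; the index \<open>j\<close> of the inner derivative becomes the second argument of
  \<open>f''\<close>.\<close>

lemma C2_UNIV_derivatives:
  fixes \<psi> :: "real^'n \<Rightarrow> complex"
  assumes "C2_UNIV \<psi>"
  obtains f' f'' where
    "\<And>x. (\<psi> has_derivative blinfun_apply (f' x)) (at x)"
    "\<And>x. (f' has_derivative blinfun_apply (f'' x)) (at x)"
    "continuous_on UNIV f''"
    "\<And>i j x. partial_deriv i (partial_deriv j \<psi>) x = blinfun_apply (blinfun_apply (f'' x) (axis i 1)) (axis j 1)"
proof -
  from assms obtain f' f'' where
    der: "\<And>x. (\<psi> has_derivative blinfun_apply (f' x)) (at x)" and
    der2: "\<And>x. (f' has_derivative blinfun_apply (f'' x)) (at x)" and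
    cont: "continuous_on UNIV f''"
    unfolding C2_UNIV_def by blast
  have "partial_deriv j \<psi> = (\<lambda>x. blinfun_apply (f' x) (axis j 1))" for j
    using frechet_derivative_at[OF der] by (auto simp: partial_deriv_def fun_eq_iff)
  moreover have "frechet_derivative (\<lambda>x. blinfun_apply (f' x) v) (at x) = (\<lambda>h. blinfun_apply (blinfun_apply (f'' x) h) v)" for v x
    using bounded_linear.has_derivative[OF blinfun.bounded_linear_left der2]
    by (rule frechet_derivative_at[symmetric])
  ultimately have "partial_deriv i (partial_deriv j \<psi>) x = blinfun_apply (blinfun_apply (f'' x) (axis i 1)) (axis j 1)" for i j x
    by (simp add: partial_deriv_def)
  with der der2 cont show ?thesis by (rule that)
qed

lemma sum_swap4:
  "(\<Sum>j\<in>J. \<Sum>k\<in>K. \<Sum>a\<in>A. \<Sum>b\<in>B. F j k a b) = (\<Sum>a\<in>A. \<Sum>b\<in>B. \<Sum>j\<in>J. \<Sum>k\<in>K. F j k a b)"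
proof -
  have swap3: "(\<Sum>k\<in>K. \<Sum>a\<in>A. \<Sum>b\<in>B. G k a b) = (\<Sum>a\<in>A. \<Sum>b\<in>B. \<Sum>k\<in>K. G k a b)" for G and K :: "'z set"
    by (subst sum.swap, intro sum.cong refl, rule sum.swap)
  show ?thesis
    unfolding swap3 ..
qed

text \<open>Derivatives are taken along real directions, whereas \<open>\<alpha> k\<close> is
  complex. It is therefore split into coordinates: the functional is indexed by pairs
  \<open>(k, b)\<close>, with coefficient \<open>\<alpha> k $ b\<close>, direction
  \<open>axis b 1\<close> and point \<open>x k\<close>.\<close>

lemma mat_quad_form_psi2_pos:
  fixes \<psi> :: "real^'n \<Rightarrow> complex" and N x \<alpha>
  assumes C2: "C2_UNIV \<psi>" and int: "integrable lborel \<psi>" and pd: "pos_def_fun \<psi>"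
  defines "Q \<equiv> mat_quad_form (psi2 \<psi>) N x \<alpha>"
  shows "Im Q = 0" "Re Q \<ge> 0" "inj_on x {..<N} \<Longrightarrow> Q = 0 \<Longrightarrow> k < N \<Longrightarrow> \<alpha> k = 0"
proof -
  obtain f' f'' where
    der: "\<And>x. (\<psi> has_derivative blinfun_apply (f' x)) (at x)" and
    der2: "\<And>x. (f' has_derivative blinfun_apply (f'' x)) (at x)" and
    partial: "\<And>i j x. partial_deriv i (partial_deriv j \<psi>) x = blinfun_apply (blinfun_apply (f'' x) (axis i 1)) (axis j 1)"
    using C2_UNIV_derivatives[OF C2] by metis
  define J where "J = {..<N} \<times> (UNIV :: 'n set)"
  define c where "c = (\<lambda>(k, b). \<alpha> k $ b)"
  define v :: "nat \<times> 'n \<Rightarrow> real^'n" where "v = (\<lambda>(k, b). axis b 1)"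
  define X where "X = (\<lambda>(k, b :: 'n). x k)"
  have "finite J" by (simp add: J_def)
  have sum_J: "(\<Sum>p\<in>J. F p) = (\<Sum>k<N. \<Sum>b\<in>UNIV. F (k, b))" for F :: "nat \<times> 'n \<Rightarrow> complex"
    unfolding J_def by (simp add: sum.cartesian_product)
  have Q: "Q = (\<Sum>i\<in>J. \<Sum>j\<in>J. cnj (c i) * c j * - blinfun_apply (blinfun_apply (f'' (X i - X j)) (v i)) (v j))"
    unfolding sum_J Q_def mat_quad_form_def
    by (intro sum.cong refl, subst sum.swap)
      (simp add: psi2_def hessian_def partial c_def v_def X_def mult_ac)
  show "Im Q = 0" "Re Q \<ge> 0"
    using pos_def_fun_derivative_energy[OF pd \<open>finite J\<close> der der2, of c X v 0 0]
    unfolding Q by simp_all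
  show "\<alpha> k = 0" if inj: "inj_on x {..<N}" and "Q = 0" and "k < N"
  proof -
    define F where "F w = (LINT z|lborel. \<psi> z * cis (w \<bullet> z))" for w
    define L where "L k w = (\<Sum>b\<in>UNIV. \<alpha> k $ b * of_real (w $ b))" for k and w :: "real^'n"
    have lin: "bounded_linear (L k)" for k
      unfolding L_def
      by (intro bounded_linear_sum bounded_linear_const_mult bounded_linear_of_real
          bounded_linear_compose[OF bounded_linear_of_real] bounded_linear_vec_nth)
    have cont': "continuous_on UNIV f'"
      using der2 by (meson continuous_at_imp_continuous_on has_derivative_continuous)
    have cont: "continuous_on UNIV \<psi>"
      using pd by (simp add: pos_def_fun_def)
    have zero: "(\<Sum>k<N. (0 + L k w) * cis (w \<bullet> x k)) * F w = 0" for w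
    proof -
      have "(\<Sum>j\<in>J. c j * blinfun_apply (f' (y - X j)) (v j)) = 0" for y
        by (rule pos_def_fun_zero_energy[OF pd \<open>finite J\<close> der der2]) (use \<open>Q = 0\<close> Q in simp)
      from Fourier_integral_derivative_combination[OF \<open>finite J\<close> int der cont' this, of w]
      show ?thesis
        by (simp add: sum_J F_def L_def c_def v_def X_def inner_axis sum_distrib_right)
    qed
    \<comment> \<open>Strict positive definiteness of \<open>\<psi>\<close> enters here, for a
      single point with coefficient 1.\<close>
    have "0 < Re (\<psi> 0)"
    proof -
      have "Im (\<psi> 0) = 0 \<and> 0 \<le> Re (\<psi> 0) \<and> \<psi> 0 \<noteq> 0"
        using pd[unfolded pos_def_fun_def Let_def, THEN conjunct2, rule_format, of "\<lambda>_. 0" 1 "\<lambda>_. 1"]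
        by (auto simp: inj_on_def)
      then show ?thesis
        by (auto simp: complex_eq_iff)
    qed
    then obtain w0 where w0: "F w0 \<noteq> 0"
      unfolding F_def using ex_Fourier_integral_nonzero[OF int cont] by blast
    let ?U = "{w. F w \<noteq> 0}"
    have "open ?U"
      using continuous_on_Fourier_integral[OF int]
      by (intro open_Collect_neq) (auto simp: F_def[abs_def])
    \<comment> \<open>On \<open>?U\<close> the factor \<open>F w\<close> can be cancelled from
      \<open>zero\<close>, leaving an exponential polynomial with linear coefficients and distinct
      frequencies \<open>x k\<close>.\<close>
    have "L k (axis b 1) = 0" for b
    proof (rule sum_cis_linear_part_eq_0[where K = "{..<N} - {k}" and U = ?U and c = "\<lambda>_. 0"])
      have "insert k ({..<N} - {k}) = {..<N}"
        using \<open>k < N\<close> by auto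
      then show "inj_on x (insert k ({..<N} - {k}))"
        "\<And>w. w \<in> ?U \<Longrightarrow> (\<Sum>k\<in>insert k ({..<N} - {k}). (0 + L k w) * cis (w \<bullet> x k)) = 0"
        using inj zero by auto
    qed (use w0 \<open>open ?U\<close> lin in auto)
    moreover have "L k (axis b 1) = \<alpha> k $ b" for b
      by (simp add: L_def axis_def if_distrib if_distribR cong: if_cong)
    ultimately show ?thesis
      by (simp add: vec_eq_iff)
  qed
qed

section \<open>Reduction of the forms of \<open>psi1\<close> and \<open>psi3\<close> to forms of
  \<open>psi2\<close>\<close>

lemma sum_axis_diff:
  fixes F :: "'n::finite \<Rightarrow> complex"
  shows "(\<Sum>b\<in>UNIV. F b * ((axis c y - axis a z :: complex^'n) $ b)) = F c * y - F a * z"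
    and "(\<Sum>b\<in>UNIV. cnj ((axis c y - axis a z :: complex^'n) $ b) * F b) = cnj y * F c - cnj z * F a"
  by (simp_all add: axis_def left_diff_distrib right_diff_distrib sum_subtractf if_distrib[of cnj]
      mult_delta_left mult_delta_right cong: if_cong)

text \<open>Only the matrix entries with indices in {a, c} survive. The case \<open>a = c\<close> is
  included, so sums over all pairs need no case distinction.\<close>

lemma sesquilinear_axis_diff:
  fixes M :: "'n::finite \<Rightarrow> 'n \<Rightarrow> complex"
  shows "(\<Sum>a'\<in>UNIV. \<Sum>b'\<in>UNIV. cnj ((axis c y - axis a z :: complex^'n) $ a') * M a' b' * ((axis c y' - axis a z' :: complex^'n) $ b'))
    = cnj y * M c c * y' - cnj y * M c a * z' - cnj z * M a c * y' + cnj z * M a a * z'"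
proof -
  have "(\<Sum>a'\<in>UNIV. \<Sum>b'\<in>UNIV. cnj ((axis c y - axis a z :: complex^'n) $ a') * M a' b' * ((axis c y' - axis a z' :: complex^'n) $ b'))
    = (\<Sum>a'\<in>UNIV. cnj ((axis c y - axis a z :: complex^'n) $ a') * (M a' c * y' - M a' a * z'))"
    by (simp only: mult.assoc sum_axis_diff(1) flip: sum_distrib_left)
  then show ?thesis
    by (simp only: sum_axis_diff(2)) (simp add: algebra_simps)
qed

text \<open>\<open>psi1\<close> is the trace of \<open>psi2\<close> times the identity, and a vector
  supported on the coordinate \<open>c\<close> sees only the diagonal entry of \<open>psi2\<close>
  at \<open>c\<close>.\<close>

lemma mat_quad_form_psi1:
  fixes \<psi> :: "real^'n \<Rightarrow> complex"
  shows "mat_quad_form (psi1 \<psi>) N x \<alpha> =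
    (\<Sum>a\<in>UNIV. \<Sum>c\<in>UNIV. mat_quad_form (psi2 \<psi>) N x (\<lambda>k. axis c (\<alpha> k $ a)))"
proof -
  have "(\<Sum>a\<in>UNIV. \<Sum>b\<in>UNIV. cnj (\<alpha> j $ a) * psi1 \<psi> y $ a $ b * \<alpha> k $ b)
      = (\<Sum>a\<in>UNIV. \<Sum>c\<in>UNIV. cnj (\<alpha> j $ a) * psi2 \<psi> y $ c $ c * \<alpha> k $ a)" for j k y
    by (simp add: psi1_def psi2_def hessian_def laplacian_def mat_def if_distrib if_distribR sum_negf
        flip: sum_distrib_left sum_distrib_right cong: if_cong)
  moreover have "(\<Sum>a'\<in>UNIV. \<Sum>b'\<in>UNIV. cnj ((axis c y :: complex^'n) $ a') * M a' b' * ((axis c y' :: complex^'n) $ b'))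
    = cnj y * M c c * y'" for c y y' and M :: "'n \<Rightarrow> 'n \<Rightarrow> complex"
    using sesquilinear_axis_diff[of c y c 0 M y' 0] by (simp add: axis_def)
  ultimately show ?thesis
    unfolding mat_quad_form_def by (simp only: sum_swap4[of _ "UNIV :: 'n set" "UNIV :: 'n set" "{..<N}" "{..<N}", symmetric])
qed

text \<open>\<open>psi3\<close> is the trace of \<open>psi2\<close> times the identity, minus
  \<open>psi2\<close>. On the right-hand side the diagonal entries give the trace part twice; the
  mixed entries give the form of \<open>psi2\<close> twice with a minus sign, by symmetry of the
  Hessian.\<close>

lemma mat_quad_form_psi3:
  fixes \<psi> :: "real^'n \<Rightarrow> complex"
  assumes sym: "\<And>i j x. partial_deriv i (partial_deriv j \<psi>) x = partial_deriv j (partial_deriv i \<psi>) x"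
  shows "2 * mat_quad_form (psi3 \<psi>) N x \<alpha> =
    (\<Sum>a\<in>UNIV. \<Sum>c\<in>UNIV. mat_quad_form (psi2 \<psi>) N x (\<lambda>k. axis c (\<alpha> k $ a) - axis a (\<alpha> k $ c)))"
proof -
  let ?T = "\<lambda>j k y a c. cnj (\<alpha> j $ a) * psi2 \<psi> y $ c $ c * \<alpha> k $ a - cnj (\<alpha> j $ a) * psi2 \<psi> y $ c $ a * \<alpha> k $ c
    - cnj (\<alpha> j $ c) * psi2 \<psi> y $ a $ c * \<alpha> k $ a + cnj (\<alpha> j $ c) * psi2 \<psi> y $ a $ a * \<alpha> k $ c"
  have T: "2 * (\<Sum>a\<in>UNIV. \<Sum>b\<in>UNIV. cnj (\<alpha> j $ a) * psi3 \<psi> y $ a $ b * \<alpha> k $ b) = (\<Sum>a\<in>UNIV. \<Sum>c\<in>UNIV. ?T j k y a c)"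
    for j k y
  proof -
    have sym2: "psi2 \<psi> y $ c $ a = psi2 \<psi> y $ a $ c" for a c
      using sym by (simp add: psi2_def hessian_def)
    let ?D = "\<Sum>a\<in>UNIV. \<Sum>c\<in>UNIV. cnj (\<alpha> j $ a) * psi2 \<psi> y $ c $ c * \<alpha> k $ a"
    let ?H = "\<Sum>a\<in>UNIV. \<Sum>c\<in>UNIV. cnj (\<alpha> j $ a) * psi2 \<psi> y $ a $ c * \<alpha> k $ c"
    have psi3: "psi3 \<psi> y $ a $ b = (if a = b then \<Sum>c\<in>UNIV. psi2 \<psi> y $ c $ c else 0) - psi2 \<psi> y $ a $ b" for a b
      by (simp add: psi3_def psi2_def hessian_def laplacian_def mat_def sum_negf)
    have "(\<Sum>a\<in>UNIV. \<Sum>b\<in>UNIV. cnj (\<alpha> j $ a) * psi3 \<psi> y $ a $ b * \<alpha> k $ b) = ?D - ?H"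
      unfolding psi3
      by (simp add: left_diff_distrib right_diff_distrib sum_subtractf mult_delta_left mult_delta_right
          sum_distrib_left sum_distrib_right)
    moreover have "(\<Sum>a\<in>UNIV. \<Sum>c\<in>UNIV. ?T j k y a c) = ?D - ?H - ?H + ?D"
    proof -
      have "(\<Sum>a\<in>UNIV. \<Sum>c\<in>UNIV. cnj (\<alpha> j $ c) * psi2 \<psi> y $ a $ c * \<alpha> k $ a) = ?H"
        by (subst sum.swap) (simp add: sym2)
      moreover have "(\<Sum>a\<in>UNIV. \<Sum>c\<in>UNIV. cnj (\<alpha> j $ c) * psi2 \<psi> y $ a $ a * \<alpha> k $ c) = ?D"
        by (rule sum.swap)
      ultimately show ?thesis
        by (simp only: sum.distrib sum_subtractf) (simp add: sym2)
    qed
    ultimately show ?thesis by simp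
  qed
  have "2 * mat_quad_form (psi3 \<psi>) N x \<alpha> = (\<Sum>j<N. \<Sum>k<N. \<Sum>a\<in>UNIV. \<Sum>c\<in>UNIV. ?T j k (x j - x k) a c)"
    unfolding mat_quad_form_def T[symmetric] by (simp only: sum_distrib_left)
  then show ?thesis
    unfolding mat_quad_form_def by (simp only: sum_swap4[of _ "UNIV :: 'n set" "UNIV :: 'n set" "{..<N}" "{..<N}", symmetric]
        sesquilinear_axis_diff)
qed

text \<open>In dimension one the Laplacian and the Hessian coincide, so \<open>psi3\<close> is
  identically zero and not positive definite; hence the condition on \<open>CARD('n)\<close> in the
  third claim.\<close>

theorem theoremA2:
  fixes \<psi> :: "real^'n \<Rightarrow> complex"
  assumes "C2_UNIV \<psi>"
    and "integrable lborel \<psi>"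
    and "pos_def_fun \<psi>"
  shows "(integrable lborel (psi1 \<psi>) \<longrightarrow> mat_pos_def_fun (psi1 \<psi>)) \<and>
         (integrable lborel (psi2 \<psi>) \<longrightarrow> mat_pos_def_fun (psi2 \<psi>)) \<and>
         (CARD('n) \<ge> 2 \<longrightarrow> integrable lborel (psi3 \<psi>) \<longrightarrow> mat_pos_def_fun (psi3 \<psi>))"
proof -
  obtain f' f'' where
    der: "\<And>x. (\<psi> has_derivative blinfun_apply (f' x)) (at x)" and
    der2: "\<And>x. (f' has_derivative blinfun_apply (f'' x)) (at x)" and
    cont: "continuous_on UNIV f''" and
    partial: "\<And>i j x. partial_deriv i (partial_deriv j \<psi>) x = blinfun_apply (blinfun_apply (f'' x) (axis i 1)) (axis j 1)"
    using C2_UNIV_derivatives[OF assms(1)] by metis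
  have sym: "partial_deriv i (partial_deriv j \<psi>) x = partial_deriv j (partial_deriv i \<psi>) x" for i j x
    unfolding partial by (rule second_derivative_symmetric[OF der der2])
  have cont_hessian: "continuous_on UNIV (hessian \<psi>)"
    unfolding hessian_def partial by (intro continuous_intros cont)
  have cont_laplacian: "continuous_on UNIV (\<lambda>x. mat (laplacian \<psi> x) :: complex^'n^'n)"
    unfolding mat_def laplacian_def partial
  proof (intro continuous_on_vec_lambda)
    fix i j :: 'n
    show "continuous_on UNIV (\<lambda>x. if i = j then \<Sum>i\<in>UNIV. blinfun_apply (blinfun_apply (f'' x) (axis i 1)) (axis i 1) else 0)"
      by (cases "i = j") (auto intro!: continuous_intros cont)
  qed
  note psi2 = mat_quad_form_psi2_pos[OF assms]
  have "mat_pos_def_fun (psi1 \<psi>)"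
    unfolding mat_pos_def_fun_def Let_def
  proof (intro conjI allI impI)
    show "continuous_on UNIV (psi1 \<psi>)"
      unfolding psi1_def by (intro continuous_intros cont_laplacian)
    fix N x and \<alpha> :: "nat \<Rightarrow> complex^'n"
    let ?E = "\<lambda>a c. mat_quad_form (psi2 \<psi>) N x (\<lambda>k. axis c (\<alpha> k $ a))"
    assume inj: "inj_on x {..<N}"
    show "Im (mat_quad_form (psi1 \<psi>) N x \<alpha>) = 0" "0 \<le> Re (mat_quad_form (psi1 \<psi>) N x \<alpha>)"
      unfolding mat_quad_form_psi1 by (simp_all add: psi2 sum_nonneg)
    fix j
    assume "mat_quad_form (psi1 \<psi>) N x \<alpha> = 0" "j < N"
    then have "(\<Sum>a\<in>UNIV. \<Sum>c\<in>UNIV. Re (?E a c)) = 0"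
      unfolding mat_quad_form_psi1 by (simp flip: Re_sum)
    \<comment> \<open>All forms of \<open>psi2\<close> have nonnegative real part, so a vanishing
      sum forces each of them to vanish.\<close>
    then have "Re (?E a c) = 0" for a c
      by (simp add: sum_nonneg_eq_0_iff sum_nonneg psi2)
    then have "?E a c = 0" for a c
      by (simp add: complex_eq_iff psi2)
    from psi2(3)[OF inj this \<open>j < N\<close>] have "axis a (\<alpha> j $ a) = (0 :: complex^'n)" for a
      by blast
    then have "\<alpha> j $ a = 0" for a
      by (metis axis_nth zero_index)
    then show "\<alpha> j = 0"
      by (simp add: vec_eq_iff)
  qed
  moreover have "mat_pos_def_fun (psi2 \<psi>)"
    unfolding mat_pos_def_fun_def Let_def
  proof (intro conjI allI impI)
    show "continuous_on UNIV (psi2 \<psi>)"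
      unfolding psi2_def by (intro continuous_intros cont_hessian)
  qed (use psi2 in blast)+
  moreover have "mat_pos_def_fun (psi3 \<psi>)" if "CARD('n) \<ge> 2"
    unfolding mat_pos_def_fun_def Let_def
  proof (intro conjI allI impI)
    show "continuous_on UNIV (psi3 \<psi>)"
      unfolding psi3_def by (intro continuous_intros cont_laplacian cont_hessian)
    fix N x and \<alpha> :: "nat \<Rightarrow> complex^'n"
    let ?E = "\<lambda>a c. mat_quad_form (psi2 \<psi>) N x (\<lambda>k. axis c (\<alpha> k $ a) - axis a (\<alpha> k $ c))"
    have "Im (2 * mat_quad_form (psi3 \<psi>) N x \<alpha>) = 0" "0 \<le> Re (2 * mat_quad_form (psi3 \<psi>) N x \<alpha>)"
      unfolding mat_quad_form_psi3[OF sym] by (simp_all add: psi2 sum_nonneg)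
    then show "Im (mat_quad_form (psi3 \<psi>) N x \<alpha>) = 0" "0 \<le> Re (mat_quad_form (psi3 \<psi>) N x \<alpha>)"
      by simp_all
    fix j
    assume inj: "inj_on x {..<N}" and "mat_quad_form (psi3 \<psi>) N x \<alpha> = 0" "j < N"
    then have "(\<Sum>a\<in>UNIV. \<Sum>c\<in>UNIV. ?E a c) = 0"
      unfolding mat_quad_form_psi3[OF sym, symmetric] by simp
    then have "(\<Sum>a\<in>UNIV. \<Sum>c\<in>UNIV. Re (?E a c)) = 0"
      by (simp flip: Re_sum)
    then have "Re (?E a c) = 0" for a c
      by (simp add: sum_nonneg_eq_0_iff sum_nonneg psi2)
    then have "?E a c = 0" for a c
      by (simp add: complex_eq_iff psi2)
    from psi2(3)[OF inj this \<open>j < N\<close>]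
    have zero: "axis c (\<alpha> j $ a) - axis a (\<alpha> j $ c) = (0 :: complex^'n)" for a c
      by blast
    \<comment> \<open>Dimension at least two provides an index \<open>c \<noteq> a\<close>, and the
      component of \<open>zero\<close> at this \<open>c\<close> is
      \<open>\<alpha> j $ a\<close>.\<close>
    have "\<alpha> j $ a = 0" for a
    proof -
      have "\<not> CARD('n) \<le> Suc 0"
        using \<open>CARD('n) \<ge> 2\<close> by simp
      then obtain c where "c \<noteq> a"
        unfolding card_le_Suc0_iff_eq[OF finite] by metis
      then show ?thesis
        using arg_cong[OF zero[of a c], of "\<lambda>z. z $ c"] by (simp add: axis_def)
    qed
    then show "\<alpha> j = 0"
      by (simp add: vec_eq_iff)
  qed
  ultimately show ?thesis by blast
qed

end
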